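(* Let $U$ be a Galois $\Gamma$-ring in $\mathcal K=(L*\mathcal M)^G$. Then $U$ is prime right Goldie if and only if $\mathcal K$ is prime right Goldie. Likewise, $U$ is semiprime right Goldie if and only if $\mathcal K$ is semiprime right Goldie.
   Context: Setting: $\Lambda$ is an integrally closed (commutative) domain, $\operatorname{Aut}(\Lambda)$ is its group of ring automorphisms (algebra automorphisms, if a base ring is fixed), $G$ is a finite subgroup of $\operatorname{Aut}(\Lambda)$ and $\mathcal M$ is a submonoid of $\operatorname{Aut}(\Lambda)$ such that (1) $\mathcal M\mathcal M^{-1}\cap G=\{e\}$; (2) $G$ acts on $\mathcal M$ by conjugation, $g\cdot\mu=g\mu g^{-1}\in\mathcal M$; (3) $\Lambda$ is a Noetherian $\Lambda^G$-module. The monoid $\mathcal M$ is assumed finitely generated. Put $L=\operatorname{Frac}\Lambda$, $\Gamma=\Lambda^G$, $K=\operatorname{Frac}\Gamma=L^G$. The skew monoid ring $\mathcal L=L*\mathcal M$ is the free left $L$-module on $\mathcal M$ with multiplication $(a\mu)(b\nu)=a\,\mu(b)\,\mu\nu$. The group $G$ acts on $\mathcal L$ by ring automorphisms via $a\mu\mapsto g(a)\,(g\cdot\mu)$, and $\mathcal K=\mathcal L^G$ is the fixed ring. A Galois $\Gamma$-ring in $\mathcal K$ is a subring $U\subseteq\mathcal K$ containing $\Gamma$ and finitely generated as a ring over $\Gamma$ such that $KU=UK=\mathcal K$. A ring is right Goldie if it has finite right uniform dimension and satisfies the ascending chain condition on right annihilators. *)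

theory Defs
  imports
    "HOL-Algebra.Bij" "HOL-Algebra.Polynomials" "HOL-Algebra.Ideal_Product" "HOL-Algebra.Generated_Rings"
begin

section \<open>Chain conditions, prime, semiprime and right Goldie rings\<close>

definition satisfies_acc :: "'a set set \<Rightarrow> bool" where
  "satisfies_acc \<S> \<longleftrightarrow>
     (\<forall>C :: nat \<Rightarrow> 'a set. (\<forall>i. C i \<in> \<S> \<and> C i \<subseteq> C (Suc i)) \<longrightarrow> (\<exists>n. \<forall>m\<ge>n. C m = C n))"

definition noetherian_module :: "('a, 'c) ring_scheme \<Rightarrow> ('a, 'b, 'd) module_scheme \<Rightarrow> bool" where
  "noetherian_module R M \<longleftrightarrow> module R M \<and> satisfies_acc {N. submodule N R M}"

text \<open>Ideals in \<^locale>\<open>ideal\<close> are two-sided, and \<^const>\<open>ideal_prod\<close> consists of all finite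
  sums of products; neither needs commutativity.\<close>

locale prime_ring = ring +
  assumes nontrivial: "\<one> \<noteq> \<zero>"
    and prime: "\<And>I J. \<lbrakk> ideal I R; ideal J R; ideal_prod R I J = {\<zero>} \<rbrakk> \<Longrightarrow> I = {\<zero>} \<or> J = {\<zero>}"

locale semiprime_ring = ring +
  assumes semiprime: "\<And>I. \<lbrakk> ideal I R; ideal_prod R I I = {\<zero>} \<rbrakk> \<Longrightarrow> I = {\<zero>}"

locale right_ideal = additive_subgroup I R + ring R for I and R (structure) +
  assumes r_closed: "\<lbrakk> a \<in> I; x \<in> carrier R \<rbrakk> \<Longrightarrow> a \<otimes> x \<in> I"

definition right_annihilator :: "('a, 'b) ring_scheme \<Rightarrow> 'a set \<Rightarrow> 'a set" where
  "right_annihilator R S = {r \<in> carrier R. \<forall>x\<in>S. x \<otimes>\<^bsub>R\<^esub> r = \<zero>\<^bsub>R\<^esub>}"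

definition uniform_right_ideal :: "('a, 'b) ring_scheme \<Rightarrow> 'a set \<Rightarrow> bool" where
  "uniform_right_ideal R V \<longleftrightarrow> right_ideal V R \<and> V \<noteq> {\<zero>\<^bsub>R\<^esub>} \<and>
     (\<forall>I J. right_ideal I R \<and> right_ideal J R \<and> I \<subseteq> V \<and> J \<subseteq> V \<and> I \<noteq> {\<zero>\<^bsub>R\<^esub>} \<and> J \<noteq> {\<zero>\<^bsub>R\<^esub>}
        \<longrightarrow> I \<inter> J \<noteq> {\<zero>\<^bsub>R\<^esub>})"

definition essential_right_ideal :: "('a, 'b) ring_scheme \<Rightarrow> 'a set \<Rightarrow> bool" where
  "essential_right_ideal R E \<longleftrightarrow> right_ideal E R \<and>
     (\<forall>J. right_ideal J R \<and> J \<noteq> {\<zero>\<^bsub>R\<^esub>} \<longrightarrow> E \<inter> J \<noteq> {\<zero>\<^bsub>R\<^esub>})"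

definition family_sum :: "('a, 'b) ring_scheme \<Rightarrow> nat \<Rightarrow> (nat \<Rightarrow> 'a set) \<Rightarrow> 'a set" where
  "family_sum R n V = {\<Oplus>\<^bsub>R\<^esub>i\<in>{..<n}. v i | v. v \<in> (\<Pi> i\<in>{..<n}. V i)}"

definition independent_family :: "('a, 'b) ring_scheme \<Rightarrow> nat \<Rightarrow> (nat \<Rightarrow> 'a set) \<Rightarrow> bool" where
  "independent_family R n V \<longleftrightarrow>
     (\<forall>v \<in> (\<Pi> i\<in>{..<n}. V i). (\<Oplus>\<^bsub>R\<^esub>i\<in>{..<n}. v i) = \<zero>\<^bsub>R\<^esub> \<longrightarrow> (\<forall>i<n. v i = \<zero>\<^bsub>R\<^esub>))"

text \<open>The right module \<open>R\<^sub>R\<close> has uniform dimension \<open>n\<close> if it has an essential submodule that is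
  a direct sum of \<open>n\<close> uniform submodules; the number \<open>n\<close> is then unique.\<close>

definition has_right_uniform_dim :: "('a, 'b) ring_scheme \<Rightarrow> nat \<Rightarrow> bool" where
  "has_right_uniform_dim R n \<longleftrightarrow>
     (\<exists>V. (\<forall>i<n. uniform_right_ideal R (V i)) \<and> independent_family R n V \<and>
          essential_right_ideal R (family_sum R n V))"

locale right_goldie_ring = ring +
  assumes finite_right_uniform_dim: "\<exists>n. has_right_uniform_dim R n"
    and acc_right_annihilators: "satisfies_acc {right_annihilator R S | S. S \<subseteq> carrier R}"


section \<open>Automorphisms, fractions and integral closure\<close>

text \<open>As for \<^const>\<open>auto\<close> in the library, automorphisms are extensional functions on the carrier,
  multiplied by composition.\<close>

definition ring_auto :: "('a, 'b) ring_scheme \<Rightarrow> ('a \<Rightarrow> 'a) set" where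
  "ring_auto R = ring_hom R R \<inter> Bij (carrier R)"

definition RingAut :: "('a, 'b) ring_scheme \<Rightarrow> ('a \<Rightarrow> 'a) monoid" where
  "RingAut R = BijGroup (carrier R) \<lparr>carrier := ring_auto R\<rparr>"

definition finitely_generated_submonoid :: "'m set \<Rightarrow> ('m, 'b) monoid_scheme \<Rightarrow> bool" where
  "finitely_generated_submonoid M A \<longleftrightarrow>
     (\<exists>F. finite F \<and> F \<subseteq> M \<and> M = \<Inter>{N. submonoid N A \<and> F \<subseteq> N})"

text \<open>All domains live inside a fixed field \<open>L\<close>: the fraction field of a subdomain is the set of
  its quotients in \<open>L\<close>.\<close>

definition fractions :: "('a, 'b) ring_scheme \<Rightarrow> 'a set \<Rightarrow> 'a set" where
  "fractions L A = {a \<otimes>\<^bsub>L\<^esub> inv\<^bsub>L\<^esub> b | a b. a \<in> A \<and> b \<in> A \<and> b \<noteq> \<zero>\<^bsub>L\<^esub>}"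

definition integral_over :: "('a, 'b) ring_scheme \<Rightarrow> 'a set \<Rightarrow> 'a \<Rightarrow> bool" where
  "integral_over L A x \<longleftrightarrow>
     (\<exists>p \<in> carrier (univ_poly L A). p \<noteq> [] \<and> lead_coeff p = \<one>\<^bsub>L\<^esub> \<and> ring.eval L p x = \<zero>\<^bsub>L\<^esub>)"

definition integrally_closed_in :: "('a, 'b) ring_scheme \<Rightarrow> 'a set \<Rightarrow> bool" where
  "integrally_closed_in L A \<longleftrightarrow> (\<forall>x \<in> carrier L. integral_over L A x \<longrightarrow> x \<in> A)"

text \<open>The extension of an automorphism of \<open>A\<close> to its fraction field, \<open>a / b \<mapsto> \<phi> a / \<phi> b\<close>.\<close>

definition frac_ext :: "('a, 'b) ring_scheme \<Rightarrow> 'a set \<Rightarrow> ('a \<Rightarrow> 'a) \<Rightarrow> 'a \<Rightarrow> 'a" where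
  "frac_ext L A \<phi> x =
     (THE y. \<exists>a\<in>A. \<exists>b\<in>A. b \<noteq> \<zero>\<^bsub>L\<^esub> \<and> x = a \<otimes>\<^bsub>L\<^esub> inv\<^bsub>L\<^esub> b \<and> y = \<phi> a \<otimes>\<^bsub>L\<^esub> inv\<^bsub>L\<^esub> (\<phi> b))"


section \<open>Skew monoid rings\<close>

text \<open>The element \<open>\<Sum>\<^sub>\<mu> f\<^sub>\<mu> \<mu>\<close> is the finitely supported coefficient function \<open>f\<close>, set to zero
  outside the monoid \<open>N\<close>. The product of \<open>f\<close> and \<open>h\<close> collects the terms
  \<open>(f\<^sub>\<mu> \<mu>) (h\<^sub>\<nu> \<nu>) = f\<^sub>\<mu> \<mu>(h\<^sub>\<nu>) \<mu>\<nu>\<close>, where \<open>\<mu>(b)\<close> is \<open>\<sigma> \<mu> b\<close>.\<close>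

definition skew_monoid_ring ::
    "('a, 'b) ring_scheme \<Rightarrow> ('m, 'c) monoid_scheme \<Rightarrow> ('m \<Rightarrow> 'a \<Rightarrow> 'a) \<Rightarrow> ('m \<Rightarrow> 'a) ring" where
  "skew_monoid_ring R N \<sigma> =
    \<lparr> carrier = {f. (\<forall>\<mu>\<in>carrier N. f \<mu> \<in> carrier R) \<and> (\<forall>\<mu>. \<mu> \<notin> carrier N \<longrightarrow> f \<mu> = \<zero>\<^bsub>R\<^esub>) \<and>
                    finite {\<mu>. f \<mu> \<noteq> \<zero>\<^bsub>R\<^esub>}},
      monoid.mult = (\<lambda>f h \<rho>. finsum R (\<lambda>(\<mu>, \<nu>). f \<mu> \<otimes>\<^bsub>R\<^esub> \<sigma> \<mu> (h \<nu>))
                {(\<mu>, \<nu>). f \<mu> \<noteq> \<zero>\<^bsub>R\<^esub> \<and> h \<nu> \<noteq> \<zero>\<^bsub>R\<^esub> \<and> \<mu> \<otimes>\<^bsub>N\<^esub> \<nu> = \<rho>}),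
      one = (\<lambda>\<rho>. if \<rho> = \<one>\<^bsub>N\<^esub> then \<one>\<^bsub>R\<^esub> else \<zero>\<^bsub>R\<^esub>),
      ring.zero = (\<lambda>\<rho>. \<zero>\<^bsub>R\<^esub>),
      add = (\<lambda>f h \<rho>. f \<rho> \<oplus>\<^bsub>R\<^esub> h \<rho>) \<rparr>"

definition skew_const ::
    "('a, 'b) ring_scheme \<Rightarrow> ('m, 'c) monoid_scheme \<Rightarrow> 'a \<Rightarrow> 'm \<Rightarrow> 'a" where
  "skew_const R N a = (\<lambda>\<rho>. if \<rho> = \<one>\<^bsub>N\<^esub> then a else \<zero>\<^bsub>R\<^esub>)"


section \<open>Galois rings\<close>

definition fixed_subring :: "'a set \<Rightarrow> ('a \<Rightarrow> 'a) set \<Rightarrow> 'a set" where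
  "fixed_subring \<Lambda> G = {a \<in> \<Lambda>. \<forall>g\<in>G. g a = a}"

locale galois_setting = field L for L (structure) +
  fixes \<Lambda> :: "'a set" and G M :: "('a \<Rightarrow> 'a) set"
  assumes subdomain: "subdomain \<Lambda> L"
    and fraction_field: "carrier L = fractions L \<Lambda>"
    and integrally_closed: "integrally_closed_in L \<Lambda>"
    and G_subgroup: "subgroup G (RingAut (L\<lparr>carrier := \<Lambda>\<rparr>))"
    and G_finite: "finite G"
    and M_submonoid: "submonoid M (RingAut (L\<lparr>carrier := \<Lambda>\<rparr>))"
    and M_finitely_generated: "finitely_generated_submonoid M (RingAut (L\<lparr>carrier := \<Lambda>\<rparr>))"
    and M_separates:
      "(M <#>\<^bsub>RingAut (L\<lparr>carrier := \<Lambda>\<rparr>)\<^esub> (set_inv\<^bsub>RingAut (L\<lparr>carrier := \<Lambda>\<rparr>)\<^esub> M)) \<inter> G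
         = {\<one>\<^bsub>RingAut (L\<lparr>carrier := \<Lambda>\<rparr>)\<^esub>}"
    and M_conjugation:
      "\<And>g \<mu>. \<lbrakk> g \<in> G; \<mu> \<in> M \<rbrakk> \<Longrightarrow>
         g \<otimes>\<^bsub>RingAut (L\<lparr>carrier := \<Lambda>\<rparr>)\<^esub> \<mu> \<otimes>\<^bsub>RingAut (L\<lparr>carrier := \<Lambda>\<rparr>)\<^esub>
           (inv\<^bsub>RingAut (L\<lparr>carrier := \<Lambda>\<rparr>)\<^esub> g) \<in> M"
    and noetherian:
      "noetherian_module (L\<lparr>carrier := fixed_subring \<Lambda> G\<rparr>)
         \<lparr> carrier = \<Lambda>, monoid.mult = monoid.mult L, one = one L, ring.zero = ring.zero L, add = add L, smult = monoid.mult L \<rparr>"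

text \<open>\<open>\<L> = L * M\<close>\<close>

definition galois_skew_ring ::
    "('a, 'b) ring_scheme \<Rightarrow> 'a set \<Rightarrow> ('a \<Rightarrow> 'a) set \<Rightarrow> (('a \<Rightarrow> 'a) \<Rightarrow> 'a) ring" where
  "galois_skew_ring L \<Lambda> M =
     skew_monoid_ring L ((RingAut (L\<lparr>carrier := \<Lambda>\<rparr>))\<lparr>carrier := M\<rparr>) (frac_ext L \<Lambda>)"

text \<open>Since \<open>g\<close> sends \<open>a \<mu>\<close> to \<open>g(a) g\<mu>g\<^sup>-\<^sup>1\<close>, the coefficient of \<open>\<rho>\<close> in \<open>g f\<close> is
  \<open>g\<close> applied to the coefficient of \<open>g\<^sup>-\<^sup>1\<rho>g\<close> in \<open>f\<close>.\<close>

definition galois_action ::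
    "('a, 'b) ring_scheme \<Rightarrow> 'a set \<Rightarrow> ('a \<Rightarrow> 'a) set \<Rightarrow> ('a \<Rightarrow> 'a) \<Rightarrow>
     (('a \<Rightarrow> 'a) \<Rightarrow> 'a) \<Rightarrow> (('a \<Rightarrow> 'a) \<Rightarrow> 'a)" where
  "galois_action L \<Lambda> M g f = (let A = RingAut (L\<lparr>carrier := \<Lambda>\<rparr>) in
     (\<lambda>\<rho>. if \<rho> \<in> M then frac_ext L \<Lambda> g (f ((inv\<^bsub>A\<^esub> g) \<otimes>\<^bsub>A\<^esub> \<rho> \<otimes>\<^bsub>A\<^esub> g)) else \<zero>\<^bsub>L\<^esub>))"

text \<open>\<open>\<K> = \<L>\<^sup>G\<close>\<close>

definition galois_fixed_ring ::
    "('a, 'b) ring_scheme \<Rightarrow> 'a set \<Rightarrow> ('a \<Rightarrow> 'a) set \<Rightarrow> ('a \<Rightarrow> 'a) set \<Rightarrow>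
     (('a \<Rightarrow> 'a) \<Rightarrow> 'a) ring" where
  "galois_fixed_ring L \<Lambda> G M =
     (galois_skew_ring L \<Lambda> M)
       \<lparr>carrier := {f \<in> carrier (galois_skew_ring L \<Lambda> M). \<forall>g\<in>G. galois_action L \<Lambda> M g f = f}\<rparr>"

text \<open>\<open>galois_embed L \<Lambda> B\<close> is the copy \<open>B e\<close> of \<open>B \<subseteq> L\<close> in \<open>\<L>\<close>; it identifies \<open>\<Gamma>\<close> and
  \<open>K = Frac \<Gamma>\<close> with subrings of \<open>\<K>\<close>.\<close>

definition galois_embed ::
    "('a, 'b) ring_scheme \<Rightarrow> 'a set \<Rightarrow> 'a set \<Rightarrow> (('a \<Rightarrow> 'a) \<Rightarrow> 'a) set" where
  "galois_embed L \<Lambda> B = skew_const L (RingAut (L\<lparr>carrier := \<Lambda>\<rparr>)) ` B"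

text \<open>\<^const>\<open>ideal_prod\<close> is used below for arbitrary subsets: \<open>ideal_prod R B C\<close> is the set of
  finite nonempty sums of products \<open>b c\<close>.\<close>

definition galois_ring ::
    "('a, 'b) ring_scheme \<Rightarrow> 'a set \<Rightarrow> ('a \<Rightarrow> 'a) set \<Rightarrow> ('a \<Rightarrow> 'a) set \<Rightarrow>
     (('a \<Rightarrow> 'a) \<Rightarrow> 'a) set \<Rightarrow> bool" where
  "galois_ring L \<Lambda> G M U \<longleftrightarrow>
     (let \<Gamma> = fixed_subring \<Lambda> G;
          K = galois_embed L \<Lambda> (fractions L \<Gamma>);
          \<K> = galois_fixed_ring L \<Lambda> G M
      in subring U \<K> \<and> galois_embed L \<Lambda> \<Gamma> \<subseteq> U \<and>
         (\<exists>S. finite S \<and> S \<subseteq> U \<and> U = generate_ring \<K> (galois_embed L \<Lambda> \<Gamma> \<union> S)) \<and>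
         ideal_prod \<K> K U = carrier \<K> \<and> ideal_prod \<K> U K = carrier \<K>)"

end

theory Submission
  imports Defs
begin

text \<open>Nonzero elements of \<open>\<Gamma>\<close> are units of \<open>\<K>\<close>, and \<open>\<K> = K U = U K\<close> says that every element of \<open>\<K>\<close>
  is a left and a right fraction of an element of \<open>U\<close> with denominator in the commutative set
  \<open>S = \<Gamma> - {0}\<close>. Hence \<open>I \<mapsto> I S\<^sup>-\<^sup>1\<close> and \<open>J \<mapsto> J \<inter> U\<close> relate the right ideals, and the right
  annihilators, of \<open>U\<close> and \<open>\<K>\<close>, so that the right Goldie conditions agree. For primeness one needs
  \<open>I S\<^sup>-\<^sup>1\<close> to be two-sided when \<open>I\<close> is an ideal of \<open>U\<close>. Here the Galois structure enters: \<open>\<Lambda>\<close> is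
  algebraic over \<open>\<Gamma>\<close>, so for \<open>c \<in> \<Gamma>\<close> and a monomial \<open>a \<mu>\<close> a polynomial relation for
  \<open>\<mu>\<^sup>-\<^sup>1(c)\<close> over \<open>\<Gamma>\<close> expresses \<open>c\<^sup>-\<^sup>1 a \<mu>\<close> as a combination of the elements \<open>c\<^sup>k a \<mu>\<close> with
  coefficients from \<open>K\<close> on the right.\<close>

section \<open>Localization at a commutative set of denominators\<close>

text \<open>The obstacle is left multiplication by \<open>c^-1\<close> on W = \<open>I S^-1\<close>.
  The usual remedy is to make the chain W \<subseteq> c^-1 W \<subseteq> c^-2 W \<subseteq> ... of
  right ideals stationary, but neither \<open>U\<close> nor \<open>\<K>\<close> is assumed to be
  Noetherian. The replacement looks at one coefficient at a time. At \<mu>, right multiplication by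
  q in \<Gamma> multiplies the coefficient by \<mu>(q), and left multiplication by c multiplies it
  by \<mu>(y), where y is the preimage of c. A relation p + y x = 0 with x in \<Gamma>[y] therefore
  kills the coefficient at \<mu>. Its constant term p has to be nonzero: all other terms carry a
  left factor c, which c^-1 cancels, and the remaining term c^-1 w p is freed of p by dividing on
  the right, where W admits inverses. Since y depends on \<mu>, different elements of the support
  cannot be treated by one relation.\<close>

lemma (in ring) right_ideal_iff:
  "right_ideal I R \<longleftrightarrow> I \<subseteq> carrier R \<and> \<zero> \<in> I \<and> (\<forall>a\<in>I. \<forall>b\<in>I. a \<oplus> b \<in> I) \<and>
     (\<forall>a\<in>I. \<forall>x\<in>carrier R. a \<otimes> x \<in> I)"
proof
  assume "right_ideal I R"
  then interpret right_ideal I R .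
  show "I \<subseteq> carrier R \<and> \<zero> \<in> I \<and> (\<forall>a\<in>I. \<forall>b\<in>I. a \<oplus> b \<in> I) \<and>
     (\<forall>a\<in>I. \<forall>x\<in>carrier R. a \<otimes> x \<in> I)"
    using a_subset r_closed by auto
next
  assume *: "I \<subseteq> carrier R \<and> \<zero> \<in> I \<and> (\<forall>a\<in>I. \<forall>b\<in>I. a \<oplus> b \<in> I) \<and>
     (\<forall>a\<in>I. \<forall>x\<in>carrier R. a \<otimes> x \<in> I)"
  \<comment> \<open>Negatives come for free, as right multiples by
    \<open>\<ominus> \<one>\<close>.\<close>
  have "\<ominus> a \<in> I" if "a \<in> I" for a
  proof -
    have "a \<in> carrier R" "a \<otimes> (\<ominus> \<one>) \<in> I" using * that by blast+
    then show ?thesis by (simp add: r_minus)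
  qed
  then have "subgroup I (add_monoid R)"
    using * by (intro add.subgroupI) (auto simp: a_inv_def)
  then show "right_ideal I R"
    using * by (intro right_ideal.intro additive_subgroupI ring_axioms right_ideal_axioms.intro) auto
qed

lemma (in ring) ideal_iff:
  "ideal I R \<longleftrightarrow> right_ideal I R \<and> (\<forall>a\<in>I. \<forall>x\<in>carrier R. x \<otimes> a \<in> I)"
proof
  assume "ideal I R"
  then interpret ideal I R .
  show "right_ideal I R \<and> (\<forall>a\<in>I. \<forall>x\<in>carrier R. x \<otimes> a \<in> I)"
    using a_subset I_l_closed I_r_closed by (auto simp: right_ideal_iff)
next
  assume *: "right_ideal I R \<and> (\<forall>a\<in>I. \<forall>x\<in>carrier R. x \<otimes> a \<in> I)"
  then interpret right_ideal I R by blast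
  show "ideal I R"
    using * r_closed by (intro idealI ring_axioms a_subgroup) auto
qed

text \<open>\<open>ideal_prod\<close> is generated by products, with no zero added as a base case,
  so it is empty when one of the sets is; hence the nonemptiness assumptions.\<close>

lemma (in ring) ideal_prod_zero_iff:
  assumes "I \<noteq> {}" "J \<noteq> {}"
  shows "ideal_prod R I J = {\<zero>} \<longleftrightarrow> (\<forall>a\<in>I. \<forall>b\<in>J. a \<otimes> b = \<zero>)"
proof
  assume "ideal_prod R I J = {\<zero>}"
  then show "\<forall>a\<in>I. \<forall>b\<in>J. a \<otimes> b = \<zero>"
    using ideal_prod.prod[of _ I _ J R] by blast
next
  assume *: "\<forall>a\<in>I. \<forall>b\<in>J. a \<otimes> b = \<zero>"
  have "x = \<zero>" if "x \<in> ideal_prod R I J" for x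
    using that by induction (use * in auto)
  moreover have "\<zero> \<in> ideal_prod R I J"
    using assms * ideal_prod.prod[of _ I _ J R] by fastforce
  ultimately show "ideal_prod R I J = {\<zero>}" by blast
qed

text \<open>No localization is constructed: \<open>S\<close> consists of units of \<open>R\<close>,
  and \<open>R\<close> itself plays that role. Elements of \<open>S\<close> commute with each other
  but need not commute with \<open>U\<close>, so fractions on the two sides are separate
  assumptions. Right fractions carry the right ideals; left fractions clear denominators in
  annihilated sets and in left factors.\<close>

locale ore_subring = ring R for R (structure) +
  fixes U S :: "'a set"
  assumes subring: "subring U R"
    and S_subset: "S \<subseteq> U"
    and S_Units: "S \<subseteq> Units R"
    and S_one: "\<one> \<in> S"
    and S_mult: "\<lbrakk> s \<in> S; t \<in> S \<rbrakk> \<Longrightarrow> s \<otimes> t \<in> S"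
    and S_comm: "\<lbrakk> s \<in> S; t \<in> S \<rbrakk> \<Longrightarrow> s \<otimes> t = t \<otimes> s"
    and right_fraction: "x \<in> carrier R \<Longrightarrow> \<exists>s\<in>S. x \<otimes> s \<in> U"
    and left_fraction: "x \<in> carrier R \<Longrightarrow> \<exists>s\<in>S. s \<otimes> x \<in> U"
begin

abbreviation P where "P \<equiv> R\<lparr>carrier := U\<rparr>"

lemma P_ring: "ring P"
  using subring_is_ring[OF subring] .

lemma U_carrier: "x \<in> U \<Longrightarrow> x \<in> carrier R"
  using subringE(1)[OF subring] by blast

lemma S_carrier: "s \<in> S \<Longrightarrow> s \<in> carrier R"
  using S_subset U_carrier by blast

lemma right_ideal_P_iff:
  "right_ideal I P \<longleftrightarrow> I \<subseteq> U \<and> \<zero> \<in> I \<and> (\<forall>a\<in>I. \<forall>b\<in>I. a \<oplus> b \<in> I) \<and>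
     (\<forall>a\<in>I. \<forall>x\<in>U. a \<otimes> x \<in> I)"
  using ring.right_ideal_iff[OF P_ring] by simp

lemma right_ideal_PD:
  assumes "right_ideal I P"
  shows "I \<subseteq> U" "\<zero> \<in> I" "\<lbrakk> a \<in> I; b \<in> I \<rbrakk> \<Longrightarrow> a \<oplus> b \<in> I" "\<lbrakk> a \<in> I; x \<in> U \<rbrakk> \<Longrightarrow> a \<otimes> x \<in> I"
  using assms by (auto simp: right_ideal_P_iff)

lemma ideal_P_iff:
  "ideal I P \<longleftrightarrow> right_ideal I P \<and> (\<forall>a\<in>I. \<forall>x\<in>U. x \<otimes> a \<in> I)"
  using ring.ideal_iff[OF P_ring] by simp

lemma ideal_prod_P: "ideal_prod P I J = ideal_prod R I J"
proof -
  have "x \<in> ideal_prod R I J" if "x \<in> ideal_prod P I J" for x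
    using that by induction (auto intro: ideal_prod.prod ideal_prod.sum)
  moreover have "x \<in> ideal_prod P I J" if "x \<in> ideal_prod R I J" for x
    using that
  proof induction
    case (prod i j)
    then show ?case using ideal_prod.prod[of i I j J P] by simp
  next
    case (sum s1 s2)
    then show ?case using ideal_prod.sum[of s1 P I J s2] by simp
  qed
  ultimately show ?thesis by blast
qed

lemma finsum_P: "f \<in> A \<rightarrow> U \<Longrightarrow> finsum P f A = finsum R f A"
proof (induction A rule: infinite_finite_induct)
  \<comment> \<open>Over an infinite index set both sums have the default value zero.\<close>
  case (infinite A)
  then show ?case
    using P_ring finsum_infinite by (simp add: finsum_def finprod_def)
next
  case empty
  interpret P: ring P by (rule P_ring)
  show ?case using P.finsum_empty finsum_empty by simp
next
  case (insert x A)
  interpret P: ring P by (rule P_ring)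
  have "f \<in> A \<rightarrow> carrier R" "f x \<in> carrier R"
    using insert.prems U_carrier by auto
  moreover have "f \<in> A \<rightarrow> U" using insert.prems by auto
  ultimately show ?case
    using insert P.finsum_insert[of A x f] finsum_insert[of A x f] by simp
qed

section \<open>Extension and contraction of right ideals\<close>

lemma S_cancel:
  assumes "x \<in> carrier R" "s \<in> S" "x \<otimes> s = \<zero>"
  shows "x = \<zero>"
proof -
  have s: "s \<in> Units R" using assms S_Units by blast
  have "x = x \<otimes> s \<otimes> inv s"
    using assms(1) s by (simp add: m_assoc Units_closed)
  then show ?thesis using assms(3) s by simp
qed

text \<open>This is \<open>I S^-1\<close>, expressed by clearing a denominator so that no inverse
  occurs.\<close>

definition extension :: "'a set \<Rightarrow> 'a set" where
  "extension I = {x \<in> carrier R. \<exists>s\<in>S. x \<otimes> s \<in> I}"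

lemma extensionI: "\<lbrakk> x \<in> carrier R; s \<in> S; x \<otimes> s \<in> I \<rbrakk> \<Longrightarrow> x \<in> extension I"
  by (auto simp: extension_def)

lemma extensionE:
  assumes "x \<in> extension I"
  obtains s where "x \<in> carrier R" "s \<in> S" "x \<otimes> s \<in> I"
  using assms by (auto simp: extension_def)

lemma extension_mono: "I \<subseteq> J \<Longrightarrow> extension I \<subseteq> extension J"
  by (auto simp: extension_def)

lemma subset_extension:
  assumes "right_ideal I P"
  shows "I \<subseteq> extension I"
proof
  fix x assume "x \<in> I"
  then have "x \<in> carrier R" "x \<otimes> \<one> \<in> I"
    using assms U_carrier by (auto simp: right_ideal_P_iff subset_iff)
  then show "x \<in> extension I" using S_one by (rule_tac extensionI)
qed

lemma right_ideal_extension: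
  assumes I: "right_ideal I P"
  shows "right_ideal (extension I) R"
  unfolding right_ideal_iff
proof (intro conjI ballI)
  show "extension I \<subseteq> carrier R" by (auto simp: extension_def)
  show "\<zero> \<in> extension I"
    using I subset_extension by (auto simp: right_ideal_P_iff)
  show "x \<oplus> y \<in> extension I" if x: "x \<in> extension I" and y: "y \<in> extension I" for x y
  proof -
    obtain s where s: "x \<in> carrier R" "s \<in> S" "x \<otimes> s \<in> I" using x by (rule extensionE)
    obtain t where t: "y \<in> carrier R" "t \<in> S" "y \<otimes> t \<in> I" using y by (rule extensionE)
    \<comment> \<open>As \<open>s\<close> and \<open>t\<close> commute, \<open>s \<otimes> t\<close>
      is a right multiple of either one, which makes it a common denominator.\<close>
    have "(x \<oplus> y) \<otimes> (s \<otimes> t) = x \<otimes> s \<otimes> t \<oplus> y \<otimes> t \<otimes> s"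
      using s t S_carrier S_comm[of s t] by (simp add: l_distr m_assoc)
    also have "\<dots> \<in> I"
      using right_ideal_PD(3,4)[OF I] s t S_subset by blast
    finally show ?thesis
      using s t S_mult by (intro extensionI[of _ "s \<otimes> t"]) auto
  qed
  show "x \<otimes> y \<in> extension I" if x: "x \<in> extension I" and y: "y \<in> carrier R" for x y
  proof -
    obtain s where s: "x \<in> carrier R" "s \<in> S" "x \<otimes> s \<in> I" using x by (rule extensionE)
    then have s': "s \<in> Units R" using S_Units by blast
    \<comment> \<open>The right Ore condition: s^-1 y is a right fraction with denominator t, so x y
      t is the product of x s in I and an element of U.\<close>
    then obtain t where t: "t \<in> S" "inv s \<otimes> y \<otimes> t \<in> U"
      using right_fraction[of "inv s \<otimes> y"] y by auto
    have "x \<otimes> y \<otimes> t = x \<otimes> (s \<otimes> inv s) \<otimes> y \<otimes> t"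
      using s s' by simp
    also have "\<dots> = x \<otimes> s \<otimes> (inv s \<otimes> y \<otimes> t)"
      using s s' t y S_carrier by (simp add: m_assoc del: Units_r_inv Units_l_inv)
    also have "\<dots> \<in> I" using s t I by (auto simp: right_ideal_P_iff)
    finally show ?thesis using s t y by (intro extensionI[of _ t]) auto
  qed
qed

lemma right_ideal_contraction:
  assumes "right_ideal J R"
  shows "right_ideal (J \<inter> U) P"
  using assms subringE[OF subring]
  by (auto simp: right_ideal_P_iff right_ideal_iff)

text \<open>Denominators are units, so a right ideal of \<open>R\<close> absorbs their inverses.
  Contraction is thus injective on right ideals of \<open>R\<close>. Extension need not be injective
  on right ideals of \<open>U\<close>; uniformity is transferred using only that it reflects zero
  and commutes with intersections.\<close>

lemma extension_contraction:
  assumes J: "right_ideal J R"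
  shows "extension (J \<inter> U) = J"
proof
  show "extension (J \<inter> U) \<subseteq> J"
  proof
    fix x assume "x \<in> extension (J \<inter> U)"
    then obtain s where s: "x \<in> carrier R" "s \<in> S" "x \<otimes> s \<in> J" by (auto elim: extensionE)
    then have s': "s \<in> Units R" using S_Units by blast
    have "x \<otimes> s \<otimes> inv s \<in> J" using s s' J by (auto simp: right_ideal_iff)
    then show "x \<in> J" using s s' by (simp add: m_assoc Units_closed)
  qed
  show "J \<subseteq> extension (J \<inter> U)"
  proof
    fix x assume x: "x \<in> J"
    then have xc: "x \<in> carrier R" using J by (auto simp: right_ideal_iff)
    then obtain s where "s \<in> S" "x \<otimes> s \<in> U" using right_fraction by blast
    then show "x \<in> extension (J \<inter> U)"
      using x xc J S_carrier by (intro extensionI[of _ s]) (auto simp: right_ideal_iff)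
  qed
qed

lemma extension_Int:
  assumes "right_ideal I P" "right_ideal J P"
  shows "extension I \<inter> extension J = extension (I \<inter> J)"
proof
  show "extension (I \<inter> J) \<subseteq> extension I \<inter> extension J"
    using extension_mono by auto
  show "extension I \<inter> extension J \<subseteq> extension (I \<inter> J)"
  proof
    fix x assume "x \<in> extension I \<inter> extension J"
    then obtain s t where x: "x \<in> carrier R" and s: "s \<in> S" "x \<otimes> s \<in> I" and t: "t \<in> S" "x \<otimes> t \<in> J"
      by (auto elim!: extensionE)
    have "x \<otimes> (s \<otimes> t) = x \<otimes> s \<otimes> t" "x \<otimes> (s \<otimes> t) = x \<otimes> t \<otimes> s"
      using x s t S_carrier S_comm[of s t] by (auto simp: m_assoc)
    then have "x \<otimes> (s \<otimes> t) \<in> I \<inter> J"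
      using right_ideal_PD(4)[OF assms(1) s(2)] right_ideal_PD(4)[OF assms(2) t(2)] s t S_subset
      by (metis IntI subsetD)
    then show "x \<in> extension (I \<inter> J)" using x s t S_mult by (intro extensionI[of _ "s \<otimes> t"]) auto
  qed
qed

lemma right_ideal_P_Int: "\<lbrakk> right_ideal I P; right_ideal J P \<rbrakk> \<Longrightarrow> right_ideal (I \<inter> J) P"
  by (auto simp: right_ideal_P_iff)

lemma extension_zero_iff:
  assumes "right_ideal I P"
  shows "extension I = {\<zero>} \<longleftrightarrow> I = {\<zero>}"
proof
  assume "extension I = {\<zero>}"
  then show "I = {\<zero>}"
    using subset_extension[OF assms] assms by (auto simp: right_ideal_P_iff)
next
  assume "I = {\<zero>}"
  then have "extension I \<subseteq> {\<zero>}" using S_cancel by (auto elim: extensionE)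
  then show "extension I = {\<zero>}"
    using right_ideal_extension[OF assms] by (auto simp: right_ideal_iff)
qed

lemma contraction_zero_iff:
  assumes "right_ideal J R"
  shows "J \<inter> U = {\<zero>} \<longleftrightarrow> J = {\<zero>}"
  using extension_zero_iff[OF right_ideal_contraction[OF assms]] extension_contraction[OF assms]
  by simp

text \<open>The product of the individual denominators works: by commutativity each of them can be
  moved to the front, and the remaining factor lies in \<open>U\<close> and is absorbed by
  \<open>V i\<close>.\<close>

lemma common_denominator:
  fixes n :: nat
  assumes "\<And>i. i < n \<Longrightarrow> right_ideal (V i) P" "\<And>i. i < n \<Longrightarrow> v i \<in> extension (V i)"
  shows "\<exists>s\<in>S. \<forall>i<n. v i \<otimes> s \<in> V i"
  using assms
proof (induction n)
  case 0
  then show ?case using S_one by auto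
next
  case (Suc n)
  then obtain s where s: "s \<in> S" "\<forall>i<n. v i \<otimes> s \<in> V i" by auto
  obtain t where t: "t \<in> S" "v n \<otimes> t \<in> V n"
    using Suc.prems(2)[of n] by (auto elim: extensionE)
  have "v i \<otimes> (s \<otimes> t) \<in> V i" if "i < Suc n" for i
  proof -
    have vi: "v i \<in> carrier R" using Suc.prems(2)[OF that] by (rule extensionE)
    have "v i \<otimes> (s \<otimes> t) = v i \<otimes> s \<otimes> t" "v i \<otimes> (s \<otimes> t) = v i \<otimes> t \<otimes> s"
      using vi s t S_carrier S_comm[of s t] by (auto simp: m_assoc)
    then show ?thesis
      using right_ideal_PD(4)[OF Suc.prems(1)[OF that]] s t S_subset that
      by (cases "i = n") (metis subsetD, metis subsetD less_SucE)
  qed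
  then show ?case using S_mult s t by blast
qed

section \<open>Uniform dimension\<close>

lemma uniform_extension:
  assumes "uniform_right_ideal P V"
  shows "uniform_right_ideal R (extension V)"
proof -
  have V: "right_ideal V P" "V \<noteq> {\<zero>}"
    and un: "\<And>I J. \<lbrakk> right_ideal I P; right_ideal J P; I \<subseteq> V; J \<subseteq> V; I \<noteq> {\<zero>}; J \<noteq> {\<zero>} \<rbrakk>
      \<Longrightarrow> I \<inter> J \<noteq> {\<zero>}"
    using assms by (auto simp: uniform_right_ideal_def)
  have "I \<inter> J \<noteq> {\<zero>}"
    if I: "right_ideal I R" "I \<subseteq> extension V" "I \<noteq> {\<zero>}"
      and J: "right_ideal J R" "J \<subseteq> extension V" "J \<noteq> {\<zero>}" for I J
  proof -
    \<comment> \<open>A nonzero \<open>K\<close> inside \<open>extension V\<close> meets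
      \<open>V\<close> itself nontrivially, since \<open>K \<inter> U \<inter> V\<close> extends to
      \<open>K \<inter> extension V\<close>, which is \<open>K\<close>.\<close>
    have *: "right_ideal (K \<inter> U \<inter> V) P" "K \<inter> U \<inter> V \<noteq> {\<zero>}"
      if K: "right_ideal K R" "K \<subseteq> extension V" "K \<noteq> {\<zero>}" for K
    proof -
      show *: "right_ideal (K \<inter> U \<inter> V) P"
        using right_ideal_P_Int right_ideal_contraction K V by blast
      have "extension (K \<inter> U \<inter> V) = K"
        using extension_Int[OF right_ideal_contraction[OF K(1)] V(1)] extension_contraction[OF K(1)] K(2)
        by auto
      then show "K \<inter> U \<inter> V \<noteq> {\<zero>}" using extension_zero_iff[OF *] K by auto
    qed
    have "(I \<inter> U \<inter> V) \<inter> (J \<inter> U \<inter> V) \<noteq> {\<zero>}"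
      using un[OF *(1)[OF I] *(1)[OF J]] *(2)[OF I] *(2)[OF J] by blast
    moreover have "right_ideal ((I \<inter> U \<inter> V) \<inter> (J \<inter> U \<inter> V)) P"
      using right_ideal_P_Int *(1)[OF I] *(1)[OF J] by blast
    ultimately show ?thesis by (auto simp: right_ideal_P_iff)
  qed
  then show ?thesis
    using V right_ideal_extension extension_zero_iff by (auto simp: uniform_right_ideal_def)
qed

lemma uniform_contraction:
  assumes "uniform_right_ideal R V"
  shows "uniform_right_ideal P (V \<inter> U)"
proof -
  have V: "right_ideal V R" "V \<noteq> {\<zero>}"
    and un: "\<And>I J. \<lbrakk> right_ideal I R; right_ideal J R; I \<subseteq> V; J \<subseteq> V; I \<noteq> {\<zero>}; J \<noteq> {\<zero>} \<rbrakk>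
      \<Longrightarrow> I \<inter> J \<noteq> {\<zero>}"
    using assms by (auto simp: uniform_right_ideal_def)
  have "I \<inter> J \<noteq> {\<zero>}"
    if I: "right_ideal I P" "I \<subseteq> V \<inter> U" "I \<noteq> {\<zero>}"
      and J: "right_ideal J P" "J \<subseteq> V \<inter> U" "J \<noteq> {\<zero>}" for I J
  proof -
    have *: "extension K \<subseteq> V" if "K \<subseteq> V \<inter> U" for K
      using extension_mono[OF that] extension_contraction[OF V(1)] by simp
    have "extension I \<inter> extension J \<noteq> {\<zero>}"
      using un[OF right_ideal_extension[OF I(1)] right_ideal_extension[OF J(1)]]
        * I J extension_zero_iff by auto
    then show ?thesis
      using extension_Int[OF I(1) J(1)] extension_zero_iff[OF right_ideal_P_Int[OF I(1) J(1)]] by simp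
  qed
  then show ?thesis
    using V right_ideal_contraction contraction_zero_iff by (auto simp: uniform_right_ideal_def)
qed

text \<open>A single denominator moves all components of a relation into the \<open>V i\<close>;
  there the relation is trivial, and the denominator cancels.\<close>

lemma independent_extension:
  assumes V: "\<And>i. i < n \<Longrightarrow> right_ideal (V i) P" and ind: "independent_family P n V"
  shows "independent_family R n (\<lambda>i. extension (V i))"
  unfolding independent_family_def
proof (intro ballI impI allI)
  fix v i assume v: "v \<in> (\<Pi> i\<in>{..<n}. extension (V i))" and sum: "(\<Oplus>i\<in>{..<n}. v i) = \<zero>"
    and i: "i < n"
  obtain s where s: "s \<in> S" "\<forall>i<n. v i \<otimes> s \<in> V i"
    using common_denominator[of n V v] V v by (auto simp: Pi_iff)
  have vc: "v \<in> {..<n} \<rightarrow> carrier R" using v by (auto simp: extension_def)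
  have "(\<Oplus>\<^bsub>P\<^esub>i\<in>{..<n}. v i \<otimes> s) = (\<Oplus>i\<in>{..<n}. v i \<otimes> s)"
    using s right_ideal_PD(1)[OF V] by (intro finsum_P) blast
  also have "\<dots> = \<zero>"
    using finsum_ldistr[of "{..<n}" s v] s vc sum S_carrier by simp
  finally have "v i \<otimes> s = \<zero>"
    using ind[unfolded independent_family_def, rule_format, of "\<lambda>i. v i \<otimes> s" i] s i by simp
  then show "v i = \<zero>" using S_cancel s i vc by auto
qed

lemma independent_contraction:
  assumes ind: "independent_family R n V"
  shows "independent_family P n (\<lambda>i. V i \<inter> U)"
  unfolding independent_family_def
proof (intro ballI impI)
  fix v assume v: "v \<in> (\<Pi> i\<in>{..<n}. V i \<inter> U)" and "(\<Oplus>\<^bsub>P\<^esub>i\<in>{..<n}. v i) = \<zero>\<^bsub>P\<^esub>"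
  moreover have "(\<Oplus>\<^bsub>P\<^esub>i\<in>{..<n}. v i) = (\<Oplus>i\<in>{..<n}. v i)"
    using v by (intro finsum_P) auto
  ultimately show "\<forall>i<n. v i = \<zero>\<^bsub>P\<^esub>"
    using ind by (auto simp: independent_family_def Pi_iff)
qed

lemma (in ring) right_ideal_family_sum:
  assumes V: "\<And>i. i < n \<Longrightarrow> right_ideal (V i) R"
  shows "right_ideal (family_sum R n V) R"
proof -
  have Vc: "v \<in> {..<n} \<rightarrow> carrier R" if "v \<in> (\<Pi> i\<in>{..<n}. V i)" for v
    using that V by (auto simp: right_ideal_iff Pi_iff subset_iff)
  show ?thesis
    unfolding right_ideal_iff
  proof (intro conjI ballI)
    show "family_sum R n V \<subseteq> carrier R"
      using finsum_closed Vc by (auto simp: family_sum_def)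
    show "\<zero> \<in> family_sum R n V"
      unfolding family_sum_def using V
      by (intro CollectI exI[of _ "\<lambda>_. \<zero>"]) (auto simp: right_ideal_iff)
    show "x \<oplus> y \<in> family_sum R n V" if x: "x \<in> family_sum R n V" and y: "y \<in> family_sum R n V" for x y
    proof -
      obtain v w where v: "v \<in> (\<Pi> i\<in>{..<n}. V i)" "x = (\<Oplus>i\<in>{..<n}. v i)"
        and w: "w \<in> (\<Pi> i\<in>{..<n}. V i)" "y = (\<Oplus>i\<in>{..<n}. w i)"
        using x y by (auto simp: family_sum_def)
      then have "x \<oplus> y = (\<Oplus>i\<in>{..<n}. v i \<oplus> w i)"
        using Vc finsum_addf[of v "{..<n}" w] by simp
      then show ?thesis
        unfolding family_sum_def using v w V
        by (intro CollectI exI[of _ "\<lambda>i. v i \<oplus> w i"]) (auto simp: right_ideal_iff Pi_iff)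
    qed
    show "x \<otimes> r \<in> family_sum R n V" if x: "x \<in> family_sum R n V" and r: "r \<in> carrier R" for x r
    proof -
      obtain v where v: "v \<in> (\<Pi> i\<in>{..<n}. V i)" "x = (\<Oplus>i\<in>{..<n}. v i)"
        using x by (auto simp: family_sum_def)
      then have "x \<otimes> r = (\<Oplus>i\<in>{..<n}. v i \<otimes> r)"
        using Vc finsum_ldistr[of "{..<n}" r v] r by simp
      then show ?thesis
        unfolding family_sum_def using v V r
        by (intro CollectI exI[of _ "\<lambda>i. v i \<otimes> r"]) (auto simp: right_ideal_iff Pi_iff)
    qed
  qed
qed

lemma essential_extension:
  assumes V: "\<And>i. i < n \<Longrightarrow> right_ideal (V i) P" and ess: "essential_right_ideal P (family_sum P n V)"
  shows "essential_right_ideal R (family_sum R n (\<lambda>i. extension (V i)))"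
  unfolding essential_right_ideal_def
proof (intro conjI allI impI)
  show "right_ideal (family_sum R n (\<lambda>i. extension (V i))) R"
    using V right_ideal_extension by (auto intro!: right_ideal_family_sum)
  fix J assume J: "right_ideal J R \<and> J \<noteq> {\<zero>}"
  have "family_sum P n V \<inter> (J \<inter> U) \<noteq> {\<zero>}"
    using ess J right_ideal_contraction contraction_zero_iff
    by (auto simp: essential_right_ideal_def)
  moreover have "\<zero> \<in> family_sum P n V \<inter> (J \<inter> U)"
    using ess right_ideal_contraction[of J] J by (auto simp: essential_right_ideal_def right_ideal_P_iff)
  moreover have "family_sum P n V \<subseteq> family_sum R n (\<lambda>i. extension (V i))"
  proof
    fix x assume "x \<in> family_sum P n V"
    then obtain v where v: "v \<in> (\<Pi> i\<in>{..<n}. V i)" "x = (\<Oplus>\<^bsub>P\<^esub>i\<in>{..<n}. v i)"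
      by (auto simp: family_sum_def)
    moreover have "(\<Oplus>\<^bsub>P\<^esub>i\<in>{..<n}. v i) = (\<Oplus>i\<in>{..<n}. v i)"
      using v V by (intro finsum_P) (auto simp: right_ideal_P_iff Pi_iff subset_iff)
    moreover have "v \<in> (\<Pi> i\<in>{..<n}. extension (V i))"
      using v V subset_extension by (auto simp: Pi_iff subset_iff)
    ultimately show "x \<in> family_sum R n (\<lambda>i. extension (V i))"
      by (auto simp: family_sum_def)
  qed
  ultimately show "family_sum R n (\<lambda>i. extension (V i)) \<inter> J \<noteq> {\<zero>}" by blast
qed

text \<open>Essentiality in \<open>R\<close> only gives a nonzero x in \<open>extension J\<close>
  that is a sum of elements of the \<open>V i\<close>. It must be brought into \<open>J\<close> and,
  summand by summand, into the \<open>V i \<inter> U\<close>. A denominator s does the latter and t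
  the former; since s t = t s, the product does both, and it is a unit, so x s t stays
  nonzero.\<close>

lemma essential_contraction:
  assumes V: "\<And>i. i < n \<Longrightarrow> right_ideal (V i) R" and ess: "essential_right_ideal R (family_sum R n V)"
  shows "essential_right_ideal P (family_sum P n (\<lambda>i. V i \<inter> U))"
  unfolding essential_right_ideal_def
proof (intro conjI allI impI)
  show fs: "right_ideal (family_sum P n (\<lambda>i. V i \<inter> U)) P"
    using V right_ideal_contraction by (auto intro!: ring.right_ideal_family_sum[OF P_ring])
  fix J assume "right_ideal J P \<and> J \<noteq> {\<zero>\<^bsub>P\<^esub>}"
  then have J: "right_ideal J P" "J \<noteq> {\<zero>}" by auto
  then have "family_sum R n V \<inter> extension J \<noteq> {\<zero>}"
    using ess right_ideal_extension extension_zero_iff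
    by (auto simp: essential_right_ideal_def)
  moreover have "\<zero> \<in> family_sum R n V \<inter> extension J"
    using ess right_ideal_extension[of J] J by (auto simp: essential_right_ideal_def right_ideal_iff)
  ultimately obtain x where x: "x \<in> family_sum R n V" "x \<in> extension J" "x \<noteq> \<zero>" by blast
  obtain v where v: "v \<in> (\<Pi> i\<in>{..<n}. V i)" "x = (\<Oplus>i\<in>{..<n}. v i)"
    using x by (auto simp: family_sum_def)
  have vc: "v \<in> {..<n} \<rightarrow> carrier R" using v V by (auto simp: right_ideal_iff Pi_iff subset_iff)
  obtain s where s: "s \<in> S" "\<forall>i<n. v i \<otimes> s \<in> V i \<inter> U"
    using common_denominator[of n "\<lambda>i. V i \<inter> U" v] v V
    by (auto simp: extension_contraction right_ideal_contraction)
  obtain t where t: "t \<in> S" "x \<otimes> t \<in> J" and xc: "x \<in> carrier R" using x by (auto elim: extensionE)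
  have st: "x \<otimes> (s \<otimes> t) = x \<otimes> s \<otimes> t" "x \<otimes> (s \<otimes> t) = x \<otimes> t \<otimes> s"
    using xc s t S_carrier S_comm[of s t] by (auto simp: m_assoc)
  have "x \<otimes> (s \<otimes> t) \<in> J"
    unfolding st(2) using right_ideal_PD(4)[OF J(1) t(2)] s S_subset by auto
  moreover have "x \<otimes> s = (\<Oplus>i\<in>{..<n}. v i \<otimes> s)"
    using finsum_ldistr[of "{..<n}" s v] s vc v S_carrier by simp
  then have "x \<otimes> s = (\<Oplus>\<^bsub>P\<^esub>i\<in>{..<n}. v i \<otimes> s)"
    using s finsum_P[of "\<lambda>i. v i \<otimes> s" "{..<n}"] by auto
  then have "x \<otimes> s \<in> family_sum P n (\<lambda>i. V i \<inter> U)"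
    using s unfolding family_sum_def by (intro CollectI exI[of _ "\<lambda>i. v i \<otimes> s"]) auto
  then have "x \<otimes> (s \<otimes> t) \<in> family_sum P n (\<lambda>i. V i \<inter> U)"
    using right_ideal_PD(4)[OF fs] t S_subset st by auto
  moreover have "x \<otimes> (s \<otimes> t) \<noteq> \<zero>"
    using S_cancel[OF xc S_mult[OF s(1) t(1)]] x by blast
  ultimately show "family_sum P n (\<lambda>i. V i \<inter> U) \<inter> J \<noteq> {\<zero>\<^bsub>P\<^esub>}" by auto
qed

lemma has_right_uniform_dim_iff: "has_right_uniform_dim P n \<longleftrightarrow> has_right_uniform_dim R n"
proof
  assume "has_right_uniform_dim P n"
  then obtain V where V: "\<forall>i<n. uniform_right_ideal P (V i)" "independent_family P n V"
    "essential_right_ideal P (family_sum P n V)"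
    by (auto simp: has_right_uniform_dim_def)
  then have "\<And>i. i < n \<Longrightarrow> right_ideal (V i) P" by (auto simp: uniform_right_ideal_def)
  then show "has_right_uniform_dim R n"
    unfolding has_right_uniform_dim_def
    using V uniform_extension independent_extension essential_extension
    by (intro exI[of _ "\<lambda>i. extension (V i)"]) auto
next
  assume "has_right_uniform_dim R n"
  then obtain V where V: "\<forall>i<n. uniform_right_ideal R (V i)" "independent_family R n V"
    "essential_right_ideal R (family_sum R n V)"
    by (auto simp: has_right_uniform_dim_def)
  then have "\<And>i. i < n \<Longrightarrow> right_ideal (V i) R" by (auto simp: uniform_right_ideal_def)
  then show "has_right_uniform_dim P n"
    unfolding has_right_uniform_dim_def
    using V uniform_contraction independent_contraction essential_contraction
    by (intro exI[of _ "\<lambda>i. V i \<inter> U"]) auto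
qed

section \<open>Right annihilators\<close>

lemma right_annihilator_P: "right_annihilator P Z = right_annihilator R Z \<inter> U"
  using U_carrier by (auto simp: right_annihilator_def)

lemma (in ring) right_ideal_right_annihilator:
  assumes "Z \<subseteq> carrier R"
  shows "right_ideal (right_annihilator R Z) R"
proof -
  have "x \<otimes> (r \<otimes> q) = \<zero>"
    if "x \<in> carrier R" "r \<in> carrier R" "q \<in> carrier R" "x \<otimes> r = \<zero>" for x r q
    using that m_assoc[of x r q] by simp
  then show ?thesis
    using assms unfolding right_ideal_iff
    by (auto simp: right_annihilator_def r_distr subset_iff)
qed

text \<open>Multiplying the elements of \<open>Z\<close> from the left by units from \<open>S\<close> moves them into \<open>U\<close> without
  changing the right annihilator.\<close>

lemma right_annihilator_numerators:
  assumes Z: "Z \<subseteq> carrier R"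
  obtains Y where "Y \<subseteq> U" "right_annihilator R Y = right_annihilator R Z"
proof -
  have "\<forall>x\<in>Z. \<exists>s\<in>S. s \<otimes> x \<in> U" using Z left_fraction by blast
  then obtain s where s: "\<forall>x\<in>Z. s x \<in> S \<and> s x \<otimes> x \<in> U" by metis
  have "s x \<otimes> x \<otimes> r = \<zero> \<longleftrightarrow> x \<otimes> r = \<zero>" if x: "x \<in> Z" and r: "r \<in> carrier R" for x r
  proof -
    have sx: "s x \<in> Units R" "x \<in> carrier R" using x s S_Units Z by auto
    then have "s x \<otimes> x \<otimes> r = \<zero> \<longleftrightarrow> s x \<otimes> (x \<otimes> r) = s x \<otimes> \<zero>"
      using r by (simp add: m_assoc Units_closed)
    then show ?thesis using sx r by (simp add: Units_l_cancel)
  qed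
  then have "right_annihilator R ((\<lambda>x. s x \<otimes> x) ` Z) = right_annihilator R Z"
    by (auto simp: right_annihilator_def)
  moreover have "(\<lambda>x. s x \<otimes> x) ` Z \<subseteq> U" using s by auto
  ultimately show thesis using that by blast
qed

text \<open>Contraction is an inclusion-preserving bijection from the right annihilators of
  \<open>R\<close> to those of \<open>U\<close>, with extension as inverse: by
  \<open>right_annihilator_numerators\<close> every annihilator of \<open>R\<close> is that of a
  subset of \<open>U\<close>, and annihilating the same subset within \<open>U\<close> is
  contracting. So chains transfer and become stationary together.\<close>

lemma acc_right_annihilators_iff:
  "satisfies_acc {right_annihilator P Z | Z. Z \<subseteq> carrier P} \<longleftrightarrow>
   satisfies_acc {right_annihilator R Z | Z. Z \<subseteq> carrier R}"
proof
  assume acc: "satisfies_acc {right_annihilator P Z | Z. Z \<subseteq> carrier P}"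
  show "satisfies_acc {right_annihilator R Z | Z. Z \<subseteq> carrier R}"
    unfolding satisfies_acc_def
  proof (intro allI impI)
    fix C assume C: "\<forall>i::nat. C i \<in> {right_annihilator R Z | Z. Z \<subseteq> carrier R} \<and> C i \<subseteq> C (Suc i)"
    have ri: "right_ideal (C i) R" for i
    proof -
      obtain Z where "Z \<subseteq> carrier R" "C i = right_annihilator R Z" using C by blast
      then show ?thesis using right_ideal_right_annihilator by simp
    qed
    have "C i \<inter> U \<in> {right_annihilator P Z | Z. Z \<subseteq> carrier P}" for i
    proof -
      obtain Z where Z: "Z \<subseteq> carrier R" "C i = right_annihilator R Z" using C by blast
      obtain Y where "Y \<subseteq> U" "right_annihilator R Y = right_annihilator R Z"
        using right_annihilator_numerators[OF Z(1)] .
      then show ?thesis using Z right_annihilator_P[of Y] by auto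
    qed
    then obtain n where n: "\<forall>m\<ge>n. C m \<inter> U = C n \<inter> U"
      using acc[unfolded satisfies_acc_def, rule_format, of "\<lambda>i. C i \<inter> U"] C by blast
    have "C m = C n" if "m \<ge> n" for m
    proof -
      have "C m = extension (C m \<inter> U)" using extension_contraction[OF ri] by simp
      also have "\<dots> = extension (C n \<inter> U)"
        by (simp only: n[rule_format, OF that])
      also have "\<dots> = C n" using extension_contraction[OF ri] .
      finally show ?thesis .
    qed
    then show "\<exists>n. \<forall>m\<ge>n. C m = C n" by blast
  qed
next
  assume acc: "satisfies_acc {right_annihilator R Z | Z. Z \<subseteq> carrier R}"
  show "satisfies_acc {right_annihilator P Z | Z. Z \<subseteq> carrier P}"
    unfolding satisfies_acc_def
  proof (intro allI impI)
    fix C assume C: "\<forall>i::nat. C i \<in> {right_annihilator P Z | Z. Z \<subseteq> carrier P} \<and> C i \<subseteq> C (Suc i)"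
    then have "\<forall>i. \<exists>Z. Z \<subseteq> U \<and> C i = right_annihilator R Z \<inter> U"
      by (simp add: right_annihilator_P) blast
    then obtain Z where Z: "\<And>i. Z i \<subseteq> U" "\<And>i. C i = right_annihilator R (Z i) \<inter> U" by metis
    have Xc: "Z i \<subseteq> carrier R" for i using Z(1) U_carrier by blast
    have ext: "extension (C i) = right_annihilator R (Z i)" for i
      using Z extension_contraction[OF right_ideal_right_annihilator[OF Xc]] by simp
    have "extension (C i) \<in> {right_annihilator R Z | Z. Z \<subseteq> carrier R}" for i
      using ext Xc by blast
    moreover have "extension (C i) \<subseteq> extension (C (Suc i))" for i
      using C extension_mono by blast
    ultimately obtain n where n: "\<forall>m\<ge>n. extension (C m) = extension (C n)"
      using acc[unfolded satisfies_acc_def, rule_format, of "\<lambda>i. extension (C i)"] by blast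
    have "C m = C n" if "m \<ge> n" for m
      by (simp only: Z(2) n[rule_format, OF that, unfolded ext])
    then show "\<exists>n. \<forall>m\<ge>n. C m = C n" by blast
  qed
qed

lemma right_goldie_iff: "right_goldie_ring P \<longleftrightarrow> right_goldie_ring R"
  using has_right_uniform_dim_iff acc_right_annihilators_iff P_ring ring_axioms
  by (simp add: right_goldie_ring_def right_goldie_ring_axioms_def)

section \<open>Two-sided ideals\<close>

lemma ideal_contraction:
  assumes "ideal J R"
  shows "ideal (J \<inter> U) P"
  using assms right_ideal_contraction[of J] subringE(6)[OF subring] U_carrier
  by (auto simp: ideal_P_iff ideal_iff)

end

text \<open>The extra assumption does not follow from the Ore conditions. Take the polynomials in
  x_i, i an integer, over a field, adjoin s with s x_i = x_(i+1) s, and let \<open>S\<close> be the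
  powers of s. The ideal generated by x_0 has an extension that contains x_0 but not s^-1 x_0 =
  x_(-1) s^-1. For Galois rings the assumption is supplied by \<open>left_division\<close>.\<close>

locale ore_subring_extending_ideals = ore_subring +
  assumes extension_left_stable:
    "\<lbrakk> ideal I (R\<lparr>carrier := U\<rparr>); x \<in> extension I; s \<in> S \<rbrakk> \<Longrightarrow> inv s \<otimes> x \<in> extension I"
begin

lemma ideal_extension:
  assumes I: "ideal I P"
  shows "ideal (extension I) R"
  unfolding ideal_iff
proof (intro conjI ballI)
  have rI: "right_ideal I P" using I by (simp add: ideal_P_iff)
  then show "right_ideal (extension I) R" by (rule right_ideal_extension)
  fix x q assume x: "x \<in> extension I" and q: "q \<in> carrier R"
  \<comment> \<open>With q = s^-1 (s q) and s q in \<open>U\<close>, left multiplication by q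
    reduces to left multiplication by s^-1.\<close>
  obtain s where s: "s \<in> S" "s \<otimes> q \<in> U" using left_fraction q by blast
  obtain t where t: "x \<in> carrier R" "t \<in> S" "x \<otimes> t \<in> I" using x by (rule extensionE)
  have sU: "s \<in> Units R" using s S_Units by blast
  have "(s \<otimes> q \<otimes> x) \<otimes> t = s \<otimes> q \<otimes> (x \<otimes> t)"
    using s t q S_carrier by (simp add: m_assoc)
  also have "\<dots> \<in> I" using I s t by (auto simp: ideal_P_iff)
  finally have "s \<otimes> q \<otimes> x \<in> extension I"
    using s t q S_carrier by (intro extensionI[of _ t]) auto
  then have "inv s \<otimes> (s \<otimes> q \<otimes> x) \<in> extension I"
    using extension_left_stable I s by blast
  moreover have "inv s \<otimes> (s \<otimes> q \<otimes> x) = q \<otimes> x"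
  proof -
    have "inv s \<otimes> (s \<otimes> q \<otimes> x) = (inv s \<otimes> s) \<otimes> (q \<otimes> x)"
      using sU q t Units_closed[OF sU] by (simp add: m_assoc del: Units_l_inv)
    then show ?thesis using sU q t by simp
  qed
  ultimately show "q \<otimes> x \<in> extension I" by simp
qed

lemma extension_prod_zero:
  assumes I: "ideal I P" and J: "ideal J P" and IJ: "ideal_prod P I J = {\<zero>}"
  shows "ideal_prod R (extension I) (extension J) = {\<zero>}"
proof -
  have eI: "ideal (extension I) R" and eJ: "ideal (extension J) R"
    using ideal_extension I J by auto
  have ne: "I \<noteq> {}" "J \<noteq> {}" "extension I \<noteq> {}" "extension J \<noteq> {}"
    using I J eI eJ by (auto simp: ideal_P_iff right_ideal_P_iff ideal_iff right_ideal_iff)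
  have zero: "\<forall>a\<in>I. \<forall>b\<in>J. a \<otimes> b = \<zero>"
    using IJ ne ideal_prod_zero_iff by (simp add: ideal_prod_P)
  have "x \<otimes> y = \<zero>" if x: "x \<in> extension I" and y: "y \<in> extension J" for x y
  proof -
    obtain s where s: "x \<in> carrier R" "s \<in> S" "x \<otimes> s \<in> I" using x by (rule extensionE)
    have sU: "s \<in> Units R" using s S_Units by blast
    have yc: "y \<in> carrier R" using y by (rule extensionE)
    \<comment> \<open>Writing x = a s^-1 with a in \<open>I\<close>, the product x y is a (s^-1 y).
      Left stability of \<open>extension J\<close> keeps s^-1 y in it, so that after clearing t the
      product of an element of \<open>I\<close> and one of \<open>J\<close> remains.\<close>
    obtain t where t: "t \<in> S" "inv s \<otimes> y \<otimes> t \<in> J"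
      using extension_left_stable[OF J y s(2)] by (auto elim: extensionE)
    have "x \<otimes> y \<otimes> t = x \<otimes> (s \<otimes> inv s) \<otimes> y \<otimes> t"
      using s sU by simp
    also have "\<dots> = x \<otimes> s \<otimes> (inv s \<otimes> y \<otimes> t)"
      using s sU t yc S_carrier by (simp add: m_assoc del: Units_r_inv Units_l_inv)
    also have "\<dots> = \<zero>" using zero s t by blast
    finally show ?thesis using S_cancel[of "x \<otimes> y" t] s t yc by simp
  qed
  then show ?thesis using ideal_prod_zero_iff ne by blast
qed

lemma contraction_prod_zero:
  assumes I: "ideal I R" and J: "ideal J R" and IJ: "ideal_prod R I J = {\<zero>}"
  shows "ideal_prod P (I \<inter> U) (J \<inter> U) = {\<zero>}"
proof -
  have "\<zero> \<in> I \<inter> U" "\<zero> \<in> J \<inter> U"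
    using ideal_contraction[OF I] ideal_contraction[OF J]
    by (auto simp: ideal_P_iff right_ideal_P_iff)
  moreover from this have "\<forall>a\<in>I. \<forall>b\<in>J. a \<otimes> b = \<zero>"
    using IJ ideal_prod_zero_iff[of I J] by blast
  ultimately show ?thesis
    unfolding ideal_prod_P by (subst ideal_prod_zero_iff) auto
qed

lemma extension_ideal_zero_iff: "ideal I P \<Longrightarrow> extension I = {\<zero>} \<longleftrightarrow> I = {\<zero>}"
  using extension_zero_iff by (simp add: ideal_P_iff)

lemma contraction_ideal_zero_iff: "ideal J R \<Longrightarrow> J \<inter> U = {\<zero>} \<longleftrightarrow> J = {\<zero>}"
  using contraction_zero_iff by (simp add: ideal_iff)

lemma prime_ring_iff: "prime_ring P \<longleftrightarrow> prime_ring R"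
proof
  assume "prime_ring P"
  then interpret P: prime_ring P .
  show "prime_ring R"
  proof
    show "\<one> \<noteq> \<zero>" using P.nontrivial by simp
    fix I J assume *: "ideal I R" "ideal J R" "ideal_prod R I J = {\<zero>}"
    then have "I \<inter> U = {\<zero>} \<or> J \<inter> U = {\<zero>}"
      using P.prime[OF ideal_contraction ideal_contraction] contraction_prod_zero by simp
    then show "I = {\<zero>} \<or> J = {\<zero>}" using * contraction_ideal_zero_iff by blast
  qed
next
  assume "prime_ring R"
  then interpret R: prime_ring R .
  interpret P: ring P by (rule P_ring)
  show "prime_ring P"
  proof
    show "\<one>\<^bsub>P\<^esub> \<noteq> \<zero>\<^bsub>P\<^esub>" using R.nontrivial by simp
    fix I J assume *: "ideal I P" "ideal J P" "ideal_prod P I J = {\<zero>\<^bsub>P\<^esub>}"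
    then have "extension I = {\<zero>} \<or> extension J = {\<zero>}"
      using R.prime[OF ideal_extension ideal_extension] extension_prod_zero by simp
    then show "I = {\<zero>\<^bsub>P\<^esub>} \<or> J = {\<zero>\<^bsub>P\<^esub>}" using * extension_ideal_zero_iff by simp
  qed
qed

lemma semiprime_ring_iff: "semiprime_ring P \<longleftrightarrow> semiprime_ring R"
proof
  assume "semiprime_ring P"
  then interpret P: semiprime_ring P .
  show "semiprime_ring R"
  proof
    fix I assume *: "ideal I R" "ideal_prod R I I = {\<zero>}"
    then have "I \<inter> U = {\<zero>}"
      using P.semiprime[OF ideal_contraction] contraction_prod_zero by simp
    then show "I = {\<zero>}" using * contraction_ideal_zero_iff by blast
  qed
next
  assume "semiprime_ring R"
  then interpret R: semiprime_ring R .
  interpret P: ring P by (rule P_ring)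
  show "semiprime_ring P"
  proof
    fix I assume *: "ideal I P" "ideal_prod P I I = {\<zero>\<^bsub>P\<^esub>}"
    then have "extension I = {\<zero>}"
      using R.semiprime[OF ideal_extension] extension_prod_zero by simp
    then show "I = {\<zero>\<^bsub>P\<^esub>}" using * extension_ideal_zero_iff by simp
  qed
qed

end

section \<open>Skew monoid rings\<close>

text \<open>The laws are asked on carriers only, because automorphisms of \<Lambda> and their
  extensions to fractions are controlled only there.\<close>

locale skew_action = R?: ring R + N?: monoid N
  for R :: "('a, 'b) ring_scheme" and N :: "('m, 'c) monoid_scheme" +
  fixes \<sigma> :: "'m \<Rightarrow> 'a \<Rightarrow> 'a"
  assumes action_hom: "\<mu> \<in> carrier N \<Longrightarrow> \<sigma> \<mu> \<in> ring_hom R R"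
    and action_one: "x \<in> carrier R \<Longrightarrow> \<sigma> \<one>\<^bsub>N\<^esub> x = x"
    and action_mult: "\<lbrakk> \<mu> \<in> carrier N; \<nu> \<in> carrier N; x \<in> carrier R \<rbrakk>
      \<Longrightarrow> \<sigma> (\<mu> \<otimes>\<^bsub>N\<^esub> \<nu>) x = \<sigma> \<mu> (\<sigma> \<nu> x)"
begin

abbreviation S where "S \<equiv> skew_monoid_ring R N \<sigma>"

definition single :: "'m \<Rightarrow> 'a \<Rightarrow> 'm \<Rightarrow> 'a" where
  "single \<mu> a = (\<lambda>\<rho>. if \<rho> = \<mu> then a else \<zero>\<^bsub>R\<^esub>)"

definition support :: "('m \<Rightarrow> 'a) \<Rightarrow> 'm set" where
  "support f = {\<mu>. f \<mu> \<noteq> \<zero>\<^bsub>R\<^esub>}"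

lemma action_closed [simp]: "\<lbrakk> \<mu> \<in> carrier N; x \<in> carrier R \<rbrakk> \<Longrightarrow> \<sigma> \<mu> x \<in> carrier R"
  using action_hom ring_hom_closed by metis

lemma action_add: "\<lbrakk> \<mu> \<in> carrier N; x \<in> carrier R; y \<in> carrier R \<rbrakk>
    \<Longrightarrow> \<sigma> \<mu> (x \<oplus>\<^bsub>R\<^esub> y) = \<sigma> \<mu> x \<oplus>\<^bsub>R\<^esub> \<sigma> \<mu> y"
  using action_hom ring_hom_add by metis

lemma action_times: "\<lbrakk> \<mu> \<in> carrier N; x \<in> carrier R; y \<in> carrier R \<rbrakk>
    \<Longrightarrow> \<sigma> \<mu> (x \<otimes>\<^bsub>R\<^esub> y) = \<sigma> \<mu> x \<otimes>\<^bsub>R\<^esub> \<sigma> \<mu> y"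
  using action_hom ring_hom_mult by metis

lemma action_unit [simp]: "\<mu> \<in> carrier N \<Longrightarrow> \<sigma> \<mu> \<one>\<^bsub>R\<^esub> = \<one>\<^bsub>R\<^esub>"
  using action_hom ring_hom_one by metis

lemma action_zero [simp]: "\<mu> \<in> carrier N \<Longrightarrow> \<sigma> \<mu> \<zero>\<^bsub>R\<^esub> = \<zero>\<^bsub>R\<^esub>"
  using ring_hom_zero[OF action_hom] R.ring_axioms by blast

lemma skew_carrier_iff:
  "f \<in> carrier S \<longleftrightarrow> (\<forall>\<mu>. f \<mu> \<in> carrier R) \<and> support f \<subseteq> carrier N \<and> finite (support f)"
  unfolding skew_monoid_ring_def support_def by auto

lemma skew_coeff [simp]: "f \<in> carrier S \<Longrightarrow> f \<mu> \<in> carrier R"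
  by (simp add: skew_carrier_iff)

lemma skew_zero: "\<zero>\<^bsub>S\<^esub> = (\<lambda>\<rho>. \<zero>\<^bsub>R\<^esub>)" and skew_one: "\<one>\<^bsub>S\<^esub> = single \<one>\<^bsub>N\<^esub> \<one>\<^bsub>R\<^esub>"
  and skew_add: "f \<oplus>\<^bsub>S\<^esub> h = (\<lambda>\<rho>. f \<rho> \<oplus>\<^bsub>R\<^esub> h \<rho>)"
  by (simp_all only: skew_monoid_ring_def single_def ring.select_convs monoid.select_convs)

lemma single_carrier: "\<lbrakk> \<mu> \<in> carrier N; a \<in> carrier R \<rbrakk> \<Longrightarrow> single \<mu> a \<in> carrier S"
proof -
  assume "\<mu> \<in> carrier N" "a \<in> carrier R"
  moreover have "support (single \<mu> a) \<subseteq> {\<mu>}" by (auto simp: support_def single_def)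
  ultimately show ?thesis
    by (auto simp: skew_carrier_iff single_def intro: finite_subset)
qed

lemma support_add: "support (f \<oplus>\<^bsub>S\<^esub> h) \<subseteq> support f \<union> support h"
  by (auto simp: support_def skew_add)

lemma skew_add_closed:
  assumes "f \<in> carrier S" "h \<in> carrier S"
  shows "f \<oplus>\<^bsub>S\<^esub> h \<in> carrier S"
  unfolding skew_carrier_iff
proof (intro conjI allI)
  show "support (f \<oplus>\<^bsub>S\<^esub> h) \<subseteq> carrier N" "finite (support (f \<oplus>\<^bsub>S\<^esub> h))"
    using assms support_add[of f h] finite_subset[OF support_add[of f h]]
    unfolding skew_carrier_iff by blast+
  show "(f \<oplus>\<^bsub>S\<^esub> h) \<rho> \<in> carrier R" for \<rho>
    using assms by (simp add: skew_add)
qed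

text \<open>Allowing index sets larger than the supports lets the products with f, f' and f + f' be
  summed over the same pairs, although cancellation may shrink the support of the sum.
  Distributivity then holds term by term.\<close>

lemma skew_mult:
  assumes f: "f \<in> carrier S" and h: "h \<in> carrier S"
    and A: "finite A" "support f \<subseteq> A" "A \<subseteq> carrier N"
    and B: "finite B" "support h \<subseteq> B" "B \<subseteq> carrier N"
  shows "(f \<otimes>\<^bsub>S\<^esub> h) \<rho> =
    finsum R (\<lambda>(\<mu>, \<nu>). f \<mu> \<otimes>\<^bsub>R\<^esub> \<sigma> \<mu> (h \<nu>))
      {(\<mu>, \<nu>). \<mu> \<in> A \<and> \<nu> \<in> B \<and> \<mu> \<otimes>\<^bsub>N\<^esub> \<nu> = \<rho>}"
proof -
  let ?I = "{(\<mu>, \<nu>). f \<mu> \<noteq> \<zero>\<^bsub>R\<^esub> \<and> h \<nu> \<noteq> \<zero>\<^bsub>R\<^esub> \<and> \<mu> \<otimes>\<^bsub>N\<^esub> \<nu> = \<rho>}"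
  let ?J = "{(\<mu>, \<nu>). \<mu> \<in> A \<and> \<nu> \<in> B \<and> \<mu> \<otimes>\<^bsub>N\<^esub> \<nu> = \<rho>}"
  have "?J \<subseteq> A \<times> B" by auto
  then have J: "finite ?J" using A B finite_subset by blast
  have "finsum R (\<lambda>(\<mu>, \<nu>). f \<mu> \<otimes>\<^bsub>R\<^esub> \<sigma> \<mu> (h \<nu>)) ?I = finsum R (\<lambda>(\<mu>, \<nu>). f \<mu> \<otimes>\<^bsub>R\<^esub> \<sigma> \<mu> (h \<nu>)) ?J"
  proof (rule R.add.finprod_mono_neutral_cong_left[OF J])
    show "?I \<subseteq> ?J" using A B by (auto simp: support_def)
    show "(case i of (\<mu>, \<nu>) \<Rightarrow> f \<mu> \<otimes>\<^bsub>R\<^esub> \<sigma> \<mu> (h \<nu>)) = \<zero>\<^bsub>R\<^esub>" if "i \<in> ?J - ?I" for i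
      using that A B f h by (auto simp: subset_iff)
    show "(\<lambda>(\<mu>, \<nu>). f \<mu> \<otimes>\<^bsub>R\<^esub> \<sigma> \<mu> (h \<nu>)) \<in> ?J \<rightarrow> carrier R"
      using A B f h by (auto simp: subset_iff)
  qed auto
  moreover have "(f \<otimes>\<^bsub>S\<^esub> h) \<rho> = finsum R (\<lambda>(\<mu>, \<nu>). f \<mu> \<otimes>\<^bsub>R\<^esub> \<sigma> \<mu> (h \<nu>)) ?I"
    by (simp only: skew_monoid_ring_def monoid.select_convs)
  ultimately show ?thesis by (simp only:)
qed

lemma skew_support:
  assumes "f \<in> carrier S"
  shows "finite (support f)" "support f \<subseteq> carrier N"
  using assms by (auto simp: skew_carrier_iff)

lemma skew_mult_closed:
  assumes f: "f \<in> carrier S" and h: "h \<in> carrier S"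
  shows "f \<otimes>\<^bsub>S\<^esub> h \<in> carrier S"
proof -
  note * = skew_mult[OF f h skew_support(1)[OF f] subset_refl skew_support(2)[OF f]
      skew_support(1)[OF h] subset_refl skew_support(2)[OF h]]
  let ?D = "(\<lambda>(\<mu>, \<nu>). \<mu> \<otimes>\<^bsub>N\<^esub> \<nu>) ` (support f \<times> support h)"
  have "(f \<otimes>\<^bsub>S\<^esub> h) \<rho> = \<zero>\<^bsub>R\<^esub>" if "\<rho> \<notin> ?D" for \<rho>
  proof -
    have "{(\<mu>, \<nu>). \<mu> \<in> support f \<and> \<nu> \<in> support h \<and> \<mu> \<otimes>\<^bsub>N\<^esub> \<nu> = \<rho>} = {}"
      using that by auto
    then show ?thesis by (simp only: * R.finsum_empty)
  qed
  then have "support (f \<otimes>\<^bsub>S\<^esub> h) \<subseteq> ?D" by (auto simp: support_def)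
  moreover have "?D \<subseteq> carrier N" "finite ?D"
    using skew_support[OF f] skew_support[OF h] by auto
  moreover have "(f \<otimes>\<^bsub>S\<^esub> h) \<rho> \<in> carrier R" for \<rho>
    unfolding * using f h skew_support(2)[OF f] by (intro R.finsum_closed) auto
  ultimately show ?thesis by (auto simp: skew_carrier_iff intro: finite_subset)
qed

lemma skew_l_distr:
  assumes f: "f \<in> carrier S" "f' \<in> carrier S" and h: "h \<in> carrier S"
  shows "(f \<oplus>\<^bsub>S\<^esub> f') \<otimes>\<^bsub>S\<^esub> h = f \<otimes>\<^bsub>S\<^esub> h \<oplus>\<^bsub>S\<^esub> f' \<otimes>\<^bsub>S\<^esub> h"
proof
  fix \<rho>
  define A where "A = support f \<union> support f'"
  have A: "finite A" "A \<subseteq> carrier N" "support f \<subseteq> A" "support f' \<subseteq> A" "support (f \<oplus>\<^bsub>S\<^esub> f') \<subseteq> A"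
    unfolding A_def using skew_support[OF f(1)] skew_support[OF f(2)] support_add by blast+
  note B = skew_support(1)[OF h] subset_refl skew_support(2)[OF h]
  let ?J = "{(\<mu>, \<nu>). \<mu> \<in> A \<and> \<nu> \<in> support h \<and> \<mu> \<otimes>\<^bsub>N\<^esub> \<nu> = \<rho>}"
  have "((f \<oplus>\<^bsub>S\<^esub> f') \<otimes>\<^bsub>S\<^esub> h) \<rho> = finsum R (\<lambda>(\<mu>, \<nu>). (f \<mu> \<oplus>\<^bsub>R\<^esub> f' \<mu>) \<otimes>\<^bsub>R\<^esub> \<sigma> \<mu> (h \<nu>)) ?J"
    using skew_mult[OF skew_add_closed[OF f] h A(1,5,2) B, of \<rho>] by (simp add: skew_add)
  also have "\<dots> = (\<Oplus>\<^bsub>R\<^esub>x\<in>?J. (case x of (\<mu>, \<nu>) \<Rightarrow> f \<mu> \<otimes>\<^bsub>R\<^esub> \<sigma> \<mu> (h \<nu>)) \<oplus>\<^bsub>R\<^esub>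
      (case x of (\<mu>, \<nu>) \<Rightarrow> f' \<mu> \<otimes>\<^bsub>R\<^esub> \<sigma> \<mu> (h \<nu>)))"
    using f h A by (intro R.finsum_cong') (auto simp: subset_iff R.l_distr)
  also have "\<dots> = (f \<otimes>\<^bsub>S\<^esub> h) \<rho> \<oplus>\<^bsub>R\<^esub> (f' \<otimes>\<^bsub>S\<^esub> h) \<rho>"
    unfolding skew_mult[OF f(1) h A(1,3,2) B] skew_mult[OF f(2) h A(1,4,2) B]
    using f h A by (intro R.finsum_addf) (auto simp: subset_iff)
  finally show "((f \<oplus>\<^bsub>S\<^esub> f') \<otimes>\<^bsub>S\<^esub> h) \<rho> = (f \<otimes>\<^bsub>S\<^esub> h \<oplus>\<^bsub>S\<^esub> f' \<otimes>\<^bsub>S\<^esub> h) \<rho>"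
    by (simp add: skew_add)
qed

lemma skew_r_distr:
  assumes f: "f \<in> carrier S" and h: "h \<in> carrier S" "h' \<in> carrier S"
  shows "f \<otimes>\<^bsub>S\<^esub> (h \<oplus>\<^bsub>S\<^esub> h') = f \<otimes>\<^bsub>S\<^esub> h \<oplus>\<^bsub>S\<^esub> f \<otimes>\<^bsub>S\<^esub> h'"
proof
  fix \<rho>
  define A where "A = support h \<union> support h'"
  have A: "finite A" "A \<subseteq> carrier N" "support h \<subseteq> A" "support h' \<subseteq> A" "support (h \<oplus>\<^bsub>S\<^esub> h') \<subseteq> A"
    unfolding A_def using skew_support[OF h(1)] skew_support[OF h(2)] support_add by blast+
  note B = skew_support(1)[OF f] subset_refl skew_support(2)[OF f]
  let ?J = "{(\<mu>, \<nu>). \<mu> \<in> support f \<and> \<nu> \<in> A \<and> \<mu> \<otimes>\<^bsub>N\<^esub> \<nu> = \<rho>}"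
  have "(f \<otimes>\<^bsub>S\<^esub> (h \<oplus>\<^bsub>S\<^esub> h')) \<rho> = finsum R (\<lambda>(\<mu>, \<nu>). f \<mu> \<otimes>\<^bsub>R\<^esub> \<sigma> \<mu> (h \<nu> \<oplus>\<^bsub>R\<^esub> h' \<nu>)) ?J"
    using skew_mult[OF f skew_add_closed[OF h] B A(1,5,2), of \<rho>] by (simp add: skew_add)
  also have "\<dots> = (\<Oplus>\<^bsub>R\<^esub>x\<in>?J. (case x of (\<mu>, \<nu>) \<Rightarrow> f \<mu> \<otimes>\<^bsub>R\<^esub> \<sigma> \<mu> (h \<nu>)) \<oplus>\<^bsub>R\<^esub>
      (case x of (\<mu>, \<nu>) \<Rightarrow> f \<mu> \<otimes>\<^bsub>R\<^esub> \<sigma> \<mu> (h' \<nu>)))"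
    using f h B by (intro R.finsum_cong') (auto simp: subset_iff R.r_distr action_add)
  also have "\<dots> = (f \<otimes>\<^bsub>S\<^esub> h) \<rho> \<oplus>\<^bsub>R\<^esub> (f \<otimes>\<^bsub>S\<^esub> h') \<rho>"
    unfolding skew_mult[OF f h(1) B A(1,3,2)] skew_mult[OF f h(2) B A(1,4,2)]
    using f h B by (intro R.finsum_addf) (auto simp: subset_iff)
  finally show "(f \<otimes>\<^bsub>S\<^esub> (h \<oplus>\<^bsub>S\<^esub> h')) \<rho> = (f \<otimes>\<^bsub>S\<^esub> h \<oplus>\<^bsub>S\<^esub> f \<otimes>\<^bsub>S\<^esub> h') \<rho>"
    by (simp add: skew_add)
qed

lemma single_mult_single:
  assumes "\<mu> \<in> carrier N" "a \<in> carrier R" "\<nu> \<in> carrier N" "b \<in> carrier R"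
  shows "single \<mu> a \<otimes>\<^bsub>S\<^esub> single \<nu> b = single (\<mu> \<otimes>\<^bsub>N\<^esub> \<nu>) (a \<otimes>\<^bsub>R\<^esub> \<sigma> \<mu> b)"
proof
  fix \<rho>
  have "(single \<mu> a \<otimes>\<^bsub>S\<^esub> single \<nu> b) \<rho> =
    finsum R (\<lambda>(\<mu>', \<nu>'). single \<mu> a \<mu>' \<otimes>\<^bsub>R\<^esub> \<sigma> \<mu>' (single \<nu> b \<nu>'))
      {(\<mu>', \<nu>'). \<mu>' \<in> {\<mu>} \<and> \<nu>' \<in> {\<nu>} \<and> \<mu>' \<otimes>\<^bsub>N\<^esub> \<nu>' = \<rho>}"
    using assms by (intro skew_mult single_carrier) (auto simp: support_def single_def)
  also have "{(\<mu>', \<nu>'). \<mu>' \<in> {\<mu>} \<and> \<nu>' \<in> {\<nu>} \<and> \<mu>' \<otimes>\<^bsub>N\<^esub> \<nu>' = \<rho>} =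
      (if \<rho> = \<mu> \<otimes>\<^bsub>N\<^esub> \<nu> then {(\<mu>, \<nu>)} else {})"
    by auto
  also have "finsum R (\<lambda>(\<mu>', \<nu>'). single \<mu> a \<mu>' \<otimes>\<^bsub>R\<^esub> \<sigma> \<mu>' (single \<nu> b \<nu>'))
      (if \<rho> = \<mu> \<otimes>\<^bsub>N\<^esub> \<nu> then {(\<mu>, \<nu>)} else {}) =
    single (\<mu> \<otimes>\<^bsub>N\<^esub> \<nu>) (a \<otimes>\<^bsub>R\<^esub> \<sigma> \<mu> b) \<rho>"
    using assms by (auto simp: single_def)
  finally show "(single \<mu> a \<otimes>\<^bsub>S\<^esub> single \<nu> b) \<rho> = single (\<mu> \<otimes>\<^bsub>N\<^esub> \<nu>) (a \<otimes>\<^bsub>R\<^esub> \<sigma> \<mu> b) \<rho>" .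
qed

text \<open>Identities additive in each argument need to be checked on monomials only.
  Associativity, the unit laws and the multiplicativity of the action of \<open>G\<close> are
  obtained in this way.\<close>

lemma skew_induct [consumes 1, case_names single add]:
  assumes "f \<in> carrier S"
    and single: "\<And>\<mu> a. \<lbrakk> \<mu> \<in> carrier N; a \<in> carrier R \<rbrakk> \<Longrightarrow> Q (single \<mu> a)"
    and add: "\<And>f h. \<lbrakk> f \<in> carrier S; h \<in> carrier S; Q f; Q h \<rbrakk> \<Longrightarrow> Q (f \<oplus>\<^bsub>S\<^esub> h)"
  shows "Q f"
proof -
  have "Q f" if "finite A" "support f \<subseteq> A" "A \<subseteq> carrier N" "f \<in> carrier S" for A f
    using that
  proof (induction A arbitrary: f rule: finite_induct)
    case empty
    \<comment> \<open>The zero element counts as a monomial with coefficient zero, so it needs no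
      case of its own.\<close>
    then have "f = single \<one>\<^bsub>N\<^esub> \<zero>\<^bsub>R\<^esub>" by (auto simp: support_def single_def)
    then show ?case using single by simp
  next
    case (insert \<mu> A)
    define h where "h = (\<lambda>\<rho>. if \<rho> = \<mu> then \<zero>\<^bsub>R\<^esub> else f \<rho>)"
    have "support h \<subseteq> A" using insert.prems(1) by (auto simp: h_def support_def)
    moreover from this have "h \<in> carrier S"
      using insert.hyps insert.prems finite_subset by (auto simp: h_def skew_carrier_iff)
    moreover have "f = single \<mu> (f \<mu>) \<oplus>\<^bsub>S\<^esub> h"
      using insert.prems(3) by (auto simp: h_def single_def skew_add)
    ultimately show ?case
      using insert add[OF single_carrier] single by (metis insert_subset skew_coeff)
  qed
  then show ?thesis using assms(1) skew_support by blast
qed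

lemma skew_assoc:
  assumes "f \<in> carrier S" "h \<in> carrier S" "k \<in> carrier S"
  shows "f \<otimes>\<^bsub>S\<^esub> h \<otimes>\<^bsub>S\<^esub> k = f \<otimes>\<^bsub>S\<^esub> (h \<otimes>\<^bsub>S\<^esub> k)"
  using assms
proof (induction f arbitrary: h k rule: skew_induct)
  case (single \<mu> a)
  from single(3,1,2,4) show ?case
  proof (induction h arbitrary: k rule: skew_induct)
    case (single \<nu> b)
    from single(5,1-4) show ?case
    proof (induction k rule: skew_induct)
      \<comment> \<open>Both bracketings give the coefficient a \<sigma>_\<mu>(b)
        \<sigma>_\<mu>(\<sigma>_\<nu>(c)) at the product of the three monoid elements.\<close>
      case (single \<kappa> c)
      then show ?case
        by (simp add: single_mult_single N.m_assoc R.m_assoc action_mult action_times)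
    next
      case (add k k')
      then show ?case by (simp add: skew_r_distr single_carrier skew_mult_closed)
    qed
  next
    case (add h h')
    then show ?case
      by (simp add: skew_r_distr skew_l_distr single_carrier skew_mult_closed)
  qed
next
  case (add f f')
  then show ?case by (simp add: skew_l_distr skew_mult_closed)
qed

lemma skew_one_closed: "\<one>\<^bsub>S\<^esub> \<in> carrier S"
  by (simp add: skew_one single_carrier)

lemma skew_l_one: "f \<in> carrier S \<Longrightarrow> \<one>\<^bsub>S\<^esub> \<otimes>\<^bsub>S\<^esub> f = f"
proof (induction f rule: skew_induct)
  case (single \<mu> a)
  then show ?case by (simp add: skew_one single_mult_single action_one)
qed (simp add: skew_r_distr skew_one_closed)

lemma skew_r_one: "f \<in> carrier S \<Longrightarrow> f \<otimes>\<^bsub>S\<^esub> \<one>\<^bsub>S\<^esub> = f"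
proof (induction f rule: skew_induct)
  case (single \<mu> a)
  then show ?case by (simp add: skew_one single_mult_single)
qed (simp add: skew_l_distr skew_one_closed)

lemma skew_minus_closed:
  assumes "f \<in> carrier S"
  shows "(\<lambda>\<rho>. \<ominus>\<^bsub>R\<^esub> f \<rho>) \<in> carrier S"
proof -
  have "support (\<lambda>\<rho>. \<ominus>\<^bsub>R\<^esub> f \<rho>) \<subseteq> support f" by (auto simp: support_def)
  then show ?thesis using assms by (auto simp: skew_carrier_iff intro: finite_subset)
qed

theorem skew_ring: "ring S"
proof (rule ringI)
  show "abelian_group S"
  proof (rule abelian_groupI)
    show "\<zero>\<^bsub>S\<^esub> \<in> carrier S" by (simp add: skew_zero skew_carrier_iff support_def)
    show "\<exists>h\<in>carrier S. h \<oplus>\<^bsub>S\<^esub> f = \<zero>\<^bsub>S\<^esub>" if "f \<in> carrier S" for f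
      using that skew_minus_closed[OF that]
      by (intro bexI[of _ "\<lambda>\<rho>. \<ominus>\<^bsub>R\<^esub> f \<rho>"]) (auto simp: skew_zero skew_add R.l_neg)
    show "f \<oplus>\<^bsub>S\<^esub> h \<oplus>\<^bsub>S\<^esub> k = f \<oplus>\<^bsub>S\<^esub> (h \<oplus>\<^bsub>S\<^esub> k)"
      if "f \<in> carrier S" "h \<in> carrier S" "k \<in> carrier S" for f h k
      using that by (simp add: skew_add R.a_assoc)
    show "f \<oplus>\<^bsub>S\<^esub> h = h \<oplus>\<^bsub>S\<^esub> f" if "f \<in> carrier S" "h \<in> carrier S" for f h
      using that by (simp add: skew_add R.a_comm)
    show "\<zero>\<^bsub>S\<^esub> \<oplus>\<^bsub>S\<^esub> f = f" if "f \<in> carrier S" for f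
      using that by (simp add: skew_add skew_zero)
  qed (rule skew_add_closed)
  show "Group.monoid S"
    by (rule monoidI) (auto simp: skew_mult_closed skew_one_closed skew_assoc skew_l_one skew_r_one)
qed (auto simp: skew_l_distr skew_r_distr)

lemma skew_uminus:
  assumes "f \<in> carrier S"
  shows "\<ominus>\<^bsub>S\<^esub> f = (\<lambda>\<rho>. \<ominus>\<^bsub>R\<^esub> f \<rho>)"
proof -
  interpret S: ring S by (rule skew_ring)
  have "(\<lambda>\<rho>. \<ominus>\<^bsub>R\<^esub> f \<rho>) \<oplus>\<^bsub>S\<^esub> f = \<zero>\<^bsub>S\<^esub>"
    using assms by (auto simp: skew_zero skew_add R.l_neg)
  then show ?thesis
    using S.minus_equality assms skew_minus_closed by blast
qed

section \<open>Multiplication by scalars on the two sides\<close>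

lemma scalar_mult:
  assumes "f \<in> carrier S" "a \<in> carrier R"
  shows "single \<one>\<^bsub>N\<^esub> a \<otimes>\<^bsub>S\<^esub> f = (\<lambda>\<rho>. a \<otimes>\<^bsub>R\<^esub> f \<rho>)"
  using assms
proof (induction f rule: skew_induct)
  case (single \<mu> b)
  then show ?case by (auto simp: single_mult_single action_one) (auto simp: single_def)
next
  case (add f h)
  then show ?case
    by (simp add: skew_r_distr single_carrier) (simp add: skew_add R.r_distr)
qed

text \<open>A scalar on the right is twisted by each monoid element that it passes, while
  \<open>scalar_mult\<close> has no twist on the left. Comparing the two is what makes division
  possible later. The zero branch is needed because \<open>\<sigma> \<rho> a\<close> is unspecified
  for \<rho> outside the monoid.\<close>

lemma mult_scalar:
  assumes "f \<in> carrier S" "a \<in> carrier R"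
  shows "f \<otimes>\<^bsub>S\<^esub> single \<one>\<^bsub>N\<^esub> a = (\<lambda>\<rho>. if \<rho> \<in> carrier N then f \<rho> \<otimes>\<^bsub>R\<^esub> \<sigma> \<rho> a else \<zero>\<^bsub>R\<^esub>)"
  using assms
proof (induction f rule: skew_induct)
  case (single \<mu> b)
  then show ?case by (auto simp: single_mult_single) (auto simp: single_def)
next
  case (add f h)
  then show ?case
    by (simp add: skew_l_distr single_carrier) (auto simp: skew_add R.l_distr)
qed

end

section \<open>Automorphisms and the fixed ring\<close>

lemma (in ring) subgroup_ring_auto: "subgroup (ring_auto R) (BijGroup (carrier R))"
proof (rule subgroup.intro)
  show "ring_auto R \<subseteq> carrier (BijGroup (carrier R))"
    by (force simp: ring_auto_def BijGroup_def)
  show "f \<otimes>\<^bsub>BijGroup (carrier R)\<^esub> g \<in> ring_auto R" if "f \<in> ring_auto R" "g \<in> ring_auto R" for f g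
  proof -
    have fg: "f \<in> ring_hom R R" "g \<in> ring_hom R R" "f \<in> Bij (carrier R)" "g \<in> Bij (carrier R)"
      using that by (auto simp: ring_auto_def)
    have "compose (carrier R) f g \<in> ring_hom R R"
      using fg(1,2) by (intro ring_hom_memI)
        (auto simp: compose_def ring_hom_closed ring_hom_mult ring_hom_add ring_hom_one)
    then show ?thesis using fg by (simp add: BijGroup_def ring_auto_def compose_Bij)
  qed
  show "\<one>\<^bsub>BijGroup (carrier R)\<^esub> \<in> ring_auto R"
    by (auto simp: BijGroup_def ring_auto_def id_Bij intro!: ring_hom_memI)
  show "inv\<^bsub>BijGroup (carrier R)\<^esub> f \<in> ring_auto R" if "f \<in> ring_auto R" for f
  proof -
    have f: "f \<in> ring_hom R R" "f \<in> Bij (carrier R)"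
      using that by (auto simp: ring_auto_def)
    have "inv_into (carrier R) f \<one> = \<one>"
      using f by (metis Bij_def IntD2 bij_betw_def inv_into_f_f mem_Collect_eq one_closed ring_hom_one)
    moreover have "inv_into (carrier R) f (x \<otimes> y) = inv_into (carrier R) f x \<otimes> inv_into (carrier R) f y"
      "inv_into (carrier R) f (x \<oplus> y) = inv_into (carrier R) f x \<oplus> inv_into (carrier R) f y"
      if "x \<in> carrier R" "y \<in> carrier R" for x y
      using that f by (auto intro!: Bij_inv_into_lemma simp: ring_hom_mult ring_hom_add)
    ultimately have "restrict (inv_into (carrier R) f) (carrier R) \<in> ring_hom R R"
      using f by (intro ring_hom_memI) (auto simp: Bij_inv_into_mem)
    then show ?thesis
      using f by (simp add: inv_BijGroup ring_auto_def restrict_inv_into_Bij del: restrict_apply)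
  qed
qed

lemma (in ring) group_RingAut: "group (RingAut R)"
  unfolding RingAut_def
  by (rule subgroup.subgroup_is_group[OF subgroup_ring_auto group_BijGroup])

lemma (in field) fraction_eq_iff:
  assumes "a \<in> carrier R" "b \<in> carrier R" "c \<in> carrier R" "d \<in> carrier R" "b \<noteq> \<zero>" "d \<noteq> \<zero>"
  shows "a \<otimes> inv b = c \<otimes> inv d \<longleftrightarrow> a \<otimes> d = c \<otimes> b"
proof -
  have u: "b \<in> Units R" "d \<in> Units R" using assms field_Units by auto
  have "a \<otimes> inv b \<otimes> (b \<otimes> d) = a \<otimes> d \<otimes> (b \<otimes> inv b)"
    using assms u Units_inv_closed by (simp add: m_ac del: Units_r_inv Units_l_inv)
  moreover have "c \<otimes> inv d \<otimes> (b \<otimes> d) = c \<otimes> b \<otimes> (d \<otimes> inv d)"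
    using assms u Units_inv_closed by (simp add: m_ac del: Units_r_inv Units_l_inv)
  moreover have "a \<otimes> inv b = c \<otimes> inv d \<longleftrightarrow> a \<otimes> inv b \<otimes> (b \<otimes> d) = c \<otimes> inv d \<otimes> (b \<otimes> d)"
    using m_rcancel[of "b \<otimes> d" "a \<otimes> inv b" "c \<otimes> inv d"] assms u integral by auto
  ultimately show ?thesis using assms u by simp
qed

context galois_setting
begin

abbreviation A where "A \<equiv> RingAut (L\<lparr>carrier := \<Lambda>\<rparr>)"
abbreviation \<Gamma> where "\<Gamma> \<equiv> fixed_subring \<Lambda> G"
abbreviation ext where "ext \<equiv> frac_ext L \<Lambda>"

lemma \<Lambda>_subring: "subring \<Lambda> L"
  using subdomain by (simp add: subdomain_def subcring_def)

lemma \<Lambda>_ring: "ring (L\<lparr>carrier := \<Lambda>\<rparr>)"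
  using subring_is_ring[OF \<Lambda>_subring] .

lemmas \<Lambda>_closed = subringE[OF \<Lambda>_subring]

lemma \<Lambda>_carrier: "x \<in> \<Lambda> \<Longrightarrow> x \<in> carrier L"
  using \<Lambda>_closed(1) by blast

lemma group_A: "group A"
  using ring.group_RingAut[OF \<Lambda>_ring] .

sublocale A: group A
  by (rule group_A)

lemma inv_closed: "\<lbrakk> x \<in> carrier L; x \<noteq> \<zero> \<rbrakk> \<Longrightarrow> inv x \<in> carrier L"
  using field_Units by auto

lemma mult_inv: "\<lbrakk> x \<in> carrier L; x \<noteq> \<zero> \<rbrakk> \<Longrightarrow> x \<otimes> inv x = \<one>" "\<lbrakk> x \<in> carrier L; x \<noteq> \<zero> \<rbrakk> \<Longrightarrow> inv x \<otimes> x = \<one>"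
  using field_Units by auto

lemma aut:
  assumes "\<phi> \<in> carrier A"
  shows aut_closed: "x \<in> \<Lambda> \<Longrightarrow> \<phi> x \<in> \<Lambda>"
    and aut_mult: "\<lbrakk> x \<in> \<Lambda>; y \<in> \<Lambda> \<rbrakk> \<Longrightarrow> \<phi> (x \<otimes> y) = \<phi> x \<otimes> \<phi> y"
    and aut_add: "\<lbrakk> x \<in> \<Lambda>; y \<in> \<Lambda> \<rbrakk> \<Longrightarrow> \<phi> (x \<oplus> y) = \<phi> x \<oplus> \<phi> y"
    and aut_one: "\<phi> \<one> = \<one>"
    and aut_zero: "\<phi> \<zero> = \<zero>"
    and aut_inj: "inj_on \<phi> \<Lambda>"
    and aut_surj: "\<phi> ` \<Lambda> = \<Lambda>"
    and aut_Bij: "\<phi> \<in> Bij \<Lambda>"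
proof -
  have hom: "\<phi> \<in> ring_hom (L\<lparr>carrier := \<Lambda>\<rparr>) (L\<lparr>carrier := \<Lambda>\<rparr>)" and bij: "\<phi> \<in> Bij \<Lambda>"
    using assms by (auto simp: RingAut_def ring_auto_def)
  show "x \<in> \<Lambda> \<Longrightarrow> \<phi> x \<in> \<Lambda>" using ring_hom_closed[OF hom] by simp
  show "\<lbrakk> x \<in> \<Lambda>; y \<in> \<Lambda> \<rbrakk> \<Longrightarrow> \<phi> (x \<otimes> y) = \<phi> x \<otimes> \<phi> y" using ring_hom_mult[OF hom] by simp
  show "\<lbrakk> x \<in> \<Lambda>; y \<in> \<Lambda> \<rbrakk> \<Longrightarrow> \<phi> (x \<oplus> y) = \<phi> x \<oplus> \<phi> y" using ring_hom_add[OF hom] by simp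
  show "\<phi> \<one> = \<one>" using ring_hom_one[OF hom] by simp
  show "\<phi> \<zero> = \<zero>" using ring_hom_zero[OF hom \<Lambda>_ring \<Lambda>_ring] by simp
  show "inj_on \<phi> \<Lambda>" "\<phi> ` \<Lambda> = \<Lambda>" "\<phi> \<in> Bij \<Lambda>"
    using bij by (auto simp: Bij_def bij_betw_def)
qed

lemma aut_zero_iff: "\<lbrakk> \<phi> \<in> carrier A; x \<in> \<Lambda> \<rbrakk> \<Longrightarrow> \<phi> x = \<zero> \<longleftrightarrow> x = \<zero>"
  using aut_inj[of \<phi>] aut_zero[of \<phi>] \<Lambda>_closed(2) by (metis inj_onD)

lemma A_mult: "\<lbrakk> \<phi> \<in> carrier A; \<psi> \<in> carrier A; x \<in> \<Lambda> \<rbrakk> \<Longrightarrow> (\<phi> \<otimes>\<^bsub>A\<^esub> \<psi>) x = \<phi> (\<psi> x)"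
  using aut_Bij[of \<phi>] aut_Bij[of \<psi>] by (simp add: RingAut_def BijGroup_def compose_def)

lemma A_one: "x \<in> \<Lambda> \<Longrightarrow> \<one>\<^bsub>A\<^esub> x = x"
  by (simp add: RingAut_def BijGroup_def)

section \<open>Extending automorphisms to the fraction field\<close>

lemma fractionE:
  assumes "x \<in> carrier L"
  obtains a b where "a \<in> \<Lambda>" "b \<in> \<Lambda>" "b \<noteq> \<zero>" "x = a \<otimes> inv b"
  using assms fraction_field by (auto simp: fractions_def)

text \<open>The definite description is well defined: a / b = c / d means a d = c b, an equation
  inside \<Lambda> that \<phi> preserves, and \<phi> keeps denominators nonzero by
  injectivity.\<close>

lemma ext_fraction:
  assumes \<phi>: "\<phi> \<in> carrier A" and ab: "a \<in> \<Lambda>" "b \<in> \<Lambda>" "b \<noteq> \<zero>"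
  shows "ext \<phi> (a \<otimes> inv b) = \<phi> a \<otimes> inv (\<phi> b)"
  unfolding frac_ext_def
proof (rule the_equality)
  show "\<exists>c\<in>\<Lambda>. \<exists>d\<in>\<Lambda>. d \<noteq> \<zero> \<and> a \<otimes> inv b = c \<otimes> inv d \<and> \<phi> a \<otimes> inv (\<phi> b) = \<phi> c \<otimes> inv (\<phi> d)"
    using ab by blast
  fix y assume "\<exists>c\<in>\<Lambda>. \<exists>d\<in>\<Lambda>. d \<noteq> \<zero> \<and> a \<otimes> inv b = c \<otimes> inv d \<and> y = \<phi> c \<otimes> inv (\<phi> d)"
  then obtain c d where cd: "c \<in> \<Lambda>" "d \<in> \<Lambda>" "d \<noteq> \<zero>" "a \<otimes> inv b = c \<otimes> inv d"
    "y = \<phi> c \<otimes> inv (\<phi> d)"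
    by blast
  then have "a \<otimes> d = c \<otimes> b" using ab \<Lambda>_carrier fraction_eq_iff by simp
  then have "\<phi> a \<otimes> \<phi> d = \<phi> c \<otimes> \<phi> b" using aut_mult[OF \<phi>] ab cd by metis
  then show "y = \<phi> a \<otimes> inv (\<phi> b)"
    using cd ab aut_closed[OF \<phi>] \<Lambda>_carrier aut_zero_iff[OF \<phi>] fraction_eq_iff by auto
qed

lemma ext_base: "\<lbrakk> \<phi> \<in> carrier A; x \<in> \<Lambda> \<rbrakk> \<Longrightarrow> ext \<phi> x = \<phi> x"
  using ext_fraction[of \<phi> x \<one>] \<Lambda>_closed(3) \<Lambda>_carrier aut_closed[of \<phi> x] aut_one[of \<phi>] by simp

lemma mult_fractions:
  assumes "a \<in> carrier L" "b \<in> carrier L" "c \<in> carrier L" "d \<in> carrier L" "b \<noteq> \<zero>" "d \<noteq> \<zero>"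
  shows "(a \<otimes> inv b) \<otimes> (c \<otimes> inv d) = (a \<otimes> c) \<otimes> inv (b \<otimes> d)"
proof -
  have "b \<in> Units L" "d \<in> Units L" using assms field_Units by auto
  then have "inv (b \<otimes> d) = inv b \<otimes> inv d" using assms comm_inv_char[of "b \<otimes> d" "inv b \<otimes> inv d"]
    by (simp add: m_ac mult_inv)
  then show ?thesis using assms inv_closed by (simp add: m_ac)
qed

lemma add_fractions:
  assumes "a \<in> carrier L" "b \<in> carrier L" "c \<in> carrier L" "d \<in> carrier L" "b \<noteq> \<zero>" "d \<noteq> \<zero>"
  shows "(a \<otimes> inv b) \<oplus> (c \<otimes> inv d) = (a \<otimes> d \<oplus> c \<otimes> b) \<otimes> inv (b \<otimes> d)"
proof -
  have "b \<otimes> d \<noteq> \<zero>" using assms integral by blast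
  moreover from this have "a \<otimes> inv b = (a \<otimes> d) \<otimes> inv (b \<otimes> d)"
    "c \<otimes> inv d = (c \<otimes> b) \<otimes> inv (b \<otimes> d)"
    using assms fraction_eq_iff[of a b "a \<otimes> d" "b \<otimes> d"] fraction_eq_iff[of c d "c \<otimes> b" "b \<otimes> d"]
    by (simp_all add: m_ac)
  ultimately show ?thesis using assms inv_closed by (simp add: l_distr)
qed

lemma ext_hom:
  assumes \<phi>: "\<phi> \<in> carrier A"
  shows "ext \<phi> \<in> ring_hom L L"
proof (rule ring_hom_memI)
  note [simp] = \<Lambda>_carrier aut_closed[OF \<phi>] aut_zero_iff[OF \<phi>] \<Lambda>_closed(6,7)
  show "ext \<phi> x \<in> carrier L" if x: "x \<in> carrier L" for x
  proof -
    obtain a b where ab: "a \<in> \<Lambda>" "b \<in> \<Lambda>" "b \<noteq> \<zero>" "x = a \<otimes> inv b"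
      using fractionE[OF x] .
    then show ?thesis using inv_closed[of "\<phi> b"] by (simp add: ext_fraction[OF \<phi>])
  qed
  fix x y assume xy: "x \<in> carrier L" "y \<in> carrier L"
  obtain a b where ab: "a \<in> \<Lambda>" "b \<in> \<Lambda>" "b \<noteq> \<zero>" "x = a \<otimes> inv b"
    using fractionE[OF xy(1)] .
  obtain c d where cd: "c \<in> \<Lambda>" "d \<in> \<Lambda>" "d \<noteq> \<zero>" "y = c \<otimes> inv d"
    using fractionE[OF xy(2)] .
  have bd: "b \<otimes> d \<noteq> \<zero>" using ab cd integral[of b d] by auto
  have "x \<otimes> y = (a \<otimes> c) \<otimes> inv (b \<otimes> d)"
    using ab cd by (simp add: mult_fractions)
  then have "ext \<phi> (x \<otimes> y) = (\<phi> a \<otimes> \<phi> c) \<otimes> inv (\<phi> b \<otimes> \<phi> d)"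
    using ab cd bd by (simp add: ext_fraction[OF \<phi>] aut_mult[OF \<phi>])
  then show "ext \<phi> (x \<otimes> y) = ext \<phi> x \<otimes> ext \<phi> y"
    using ab cd by (simp add: ext_fraction[OF \<phi>] mult_fractions)
  have "x \<oplus> y = (a \<otimes> d \<oplus> c \<otimes> b) \<otimes> inv (b \<otimes> d)"
    using ab cd by (simp add: add_fractions)
  then have "ext \<phi> (x \<oplus> y) = (\<phi> a \<otimes> \<phi> d \<oplus> \<phi> c \<otimes> \<phi> b) \<otimes> inv (\<phi> b \<otimes> \<phi> d)"
    using ab cd bd by (simp add: ext_fraction[OF \<phi>] aut_mult[OF \<phi>] aut_add[OF \<phi>])
  then show "ext \<phi> (x \<oplus> y) = ext \<phi> x \<oplus> ext \<phi> y"
    using ab cd by (simp add: ext_fraction[OF \<phi>] add_fractions)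
next
  show "ext \<phi> \<one> = \<one>" using ext_base[OF \<phi> \<Lambda>_closed(3)] aut_one[OF \<phi>] by simp
qed

lemma ext_mult:
  assumes "\<phi> \<in> carrier A" "\<psi> \<in> carrier A" "x \<in> carrier L"
  shows "ext (\<phi> \<otimes>\<^bsub>A\<^esub> \<psi>) x = ext \<phi> (ext \<psi> x)"
proof -
  obtain a b where "a \<in> \<Lambda>" "b \<in> \<Lambda>" "b \<noteq> \<zero>" "x = a \<otimes> inv b" using fractionE[OF assms(3)] .
  then show ?thesis
    using assms by (simp add: ext_fraction A_mult aut_closed aut_zero_iff)
qed

lemma ext_one: "x \<in> carrier L \<Longrightarrow> ext \<one>\<^bsub>A\<^esub> x = x"
  by (erule fractionE) (simp add: ext_fraction A_one)

lemma M_carrier: "\<mu> \<in> M \<Longrightarrow> \<mu> \<in> carrier A"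
  using M_submonoid by (auto dest: submonoid.subset)

lemma G_carrier: "g \<in> G \<Longrightarrow> g \<in> carrier A"
  using G_subgroup by (auto dest: subgroup.subset)

sublocale skew: skew_action L "A\<lparr>carrier := M\<rparr>" "frac_ext L \<Lambda>"
proof (intro skew_action.intro skew_action_axioms.intro)
  show "ring L" by (rule ring_axioms)
  show "Group.monoid (A\<lparr>carrier := M\<rparr>)"
    using submonoid.submonoid_is_monoid[OF M_submonoid A.monoid_axioms] .
qed (auto simp: ext_hom ext_one ext_mult M_carrier)

section \<open>The action of \<open>G\<close> and its fixed ring\<close>

abbreviation \<K> where "\<K> \<equiv> galois_fixed_ring L \<Lambda> G M"
abbreviation conj where "conj g \<mu> \<equiv> g \<otimes>\<^bsub>A\<^esub> \<mu> \<otimes>\<^bsub>A\<^esub> inv\<^bsub>A\<^esub> g"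

sublocale skew: ring skew.S
  by (rule skew.skew_ring)

lemma conj_closed: "\<lbrakk> g \<in> G; \<mu> \<in> M \<rbrakk> \<Longrightarrow> conj g \<mu> \<in> M"
  using M_conjugation .

text \<open>The action is defined by reading coefficients at g^-1 \<rho> g, whereas on monomials it
  moves \<mu> to g \<mu> g^-1; this passes between the two descriptions.\<close>

lemma conj_eq_iff:
  assumes "g \<in> carrier A" "\<mu> \<in> carrier A" "\<rho> \<in> carrier A"
  shows "inv\<^bsub>A\<^esub> g \<otimes>\<^bsub>A\<^esub> \<rho> \<otimes>\<^bsub>A\<^esub> g = \<mu> \<longleftrightarrow> \<rho> = conj g \<mu>"
proof
  assume \<mu>: "inv\<^bsub>A\<^esub> g \<otimes>\<^bsub>A\<^esub> \<rho> \<otimes>\<^bsub>A\<^esub> g = \<mu>"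
  have "conj g \<mu> = (g \<otimes>\<^bsub>A\<^esub> inv\<^bsub>A\<^esub> g) \<otimes>\<^bsub>A\<^esub> \<rho> \<otimes>\<^bsub>A\<^esub> (g \<otimes>\<^bsub>A\<^esub> inv\<^bsub>A\<^esub> g)"
    unfolding \<mu>[symmetric] using assms by (simp add: A.m_assoc del: A.r_inv A.Units_r_inv)
  then show "\<rho> = conj g \<mu>" using assms by simp
next
  assume "\<rho> = conj g \<mu>"
  then have "inv\<^bsub>A\<^esub> g \<otimes>\<^bsub>A\<^esub> \<rho> \<otimes>\<^bsub>A\<^esub> g = (inv\<^bsub>A\<^esub> g \<otimes>\<^bsub>A\<^esub> g) \<otimes>\<^bsub>A\<^esub> \<mu> \<otimes>\<^bsub>A\<^esub> (inv\<^bsub>A\<^esub> g \<otimes>\<^bsub>A\<^esub> g)"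
    using assms by (simp add: A.m_assoc del: A.l_inv A.Units_l_inv)
  then show "inv\<^bsub>A\<^esub> g \<otimes>\<^bsub>A\<^esub> \<rho> \<otimes>\<^bsub>A\<^esub> g = \<mu>" using assms by simp
qed

lemma conj_mult:
  assumes "g \<in> carrier A" "\<mu> \<in> carrier A" "\<nu> \<in> carrier A"
  shows "conj g \<mu> \<otimes>\<^bsub>A\<^esub> conj g \<nu> = conj g (\<mu> \<otimes>\<^bsub>A\<^esub> \<nu>)"
proof -
  have "conj g \<mu> \<otimes>\<^bsub>A\<^esub> conj g \<nu> = g \<otimes>\<^bsub>A\<^esub> \<mu> \<otimes>\<^bsub>A\<^esub> (inv\<^bsub>A\<^esub> g \<otimes>\<^bsub>A\<^esub> g) \<otimes>\<^bsub>A\<^esub> \<nu> \<otimes>\<^bsub>A\<^esub> inv\<^bsub>A\<^esub> g"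
    using assms by (simp add: A.m_assoc del: A.l_inv A.Units_l_inv)
  then show ?thesis using assms by (simp add: A.m_assoc)
qed

context
  fixes g assumes g: "g \<in> G"
begin

lemma action_apply:
  "galois_action L \<Lambda> M g f \<rho> =
     (if \<rho> \<in> M then ext g (f (inv\<^bsub>A\<^esub> g \<otimes>\<^bsub>A\<^esub> \<rho> \<otimes>\<^bsub>A\<^esub> g)) else \<zero>)"
  by (simp add: galois_action_def Let_def)

lemma ext_G_hom: "ext g \<in> ring_hom L L"
  using ext_hom[OF G_carrier[OF g]] .

lemma action_single:
  assumes "\<mu> \<in> M" "a \<in> carrier L"
  shows "galois_action L \<Lambda> M g (skew.single \<mu> a) = skew.single (conj g \<mu>) (ext g a)"
proof
  fix \<rho>
  have "ext g \<zero> = \<zero>" using ring_hom_zero[OF ext_G_hom ring_axioms ring_axioms] .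
  then show "galois_action L \<Lambda> M g (skew.single \<mu> a) \<rho> = skew.single (conj g \<mu>) (ext g a) \<rho>"
    using conj_eq_iff[of g \<mu> \<rho>] conj_closed[OF g assms(1)] G_carrier[OF g] M_carrier assms
    by (auto simp: action_apply skew.single_def)
qed

lemma action_add:
  assumes "f \<in> carrier skew.S" "h \<in> carrier skew.S"
  shows "galois_action L \<Lambda> M g (f \<oplus>\<^bsub>skew.S\<^esub> h) =
    galois_action L \<Lambda> M g f \<oplus>\<^bsub>skew.S\<^esub> galois_action L \<Lambda> M g h"
  using assms ring_hom_add[OF ext_G_hom] by (auto simp: action_apply skew.skew_add)

lemma action_carrier:
  "f \<in> carrier skew.S \<Longrightarrow> galois_action L \<Lambda> M g f \<in> carrier skew.S"
proof (induction f rule: skew.skew_induct)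
  case (single \<mu> a)
  then show ?case
    using conj_closed[OF g] ring_hom_closed[OF ext_G_hom]
    by (simp add: action_single skew.single_carrier)
next
  case (add f h)
  then show ?case by (simp add: action_add skew.skew_add_closed)
qed

lemma action_mult:
  assumes "f \<in> carrier skew.S" "h \<in> carrier skew.S"
  shows "galois_action L \<Lambda> M g (f \<otimes>\<^bsub>skew.S\<^esub> h) =
    galois_action L \<Lambda> M g f \<otimes>\<^bsub>skew.S\<^esub> galois_action L \<Lambda> M g h"
  using assms
proof (induction f arbitrary: h rule: skew.skew_induct)
  case (single \<mu> a)
  from single(3,1,2) show ?case
  proof (induction h rule: skew.skew_induct)
    case (single \<nu> b)
    then have M: "\<mu> \<in> M" "\<nu> \<in> M" "\<mu> \<otimes>\<^bsub>A\<^esub> \<nu> \<in> M" "conj g \<mu> \<in> M" "conj g \<nu> \<in> M"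
      using submonoid.m_closed[OF M_submonoid] conj_closed[OF g] by auto
    note c = G_carrier[OF g] M[THEN M_carrier]
    \<comment> \<open>The compatibility behind multiplicativity: g \<mu> g^-1 applied after g is g
      applied after \<mu>, so twisting by \<mu> and then acting equals acting and then twisting by
      the conjugate.\<close>
    have "ext (conj g \<mu>) (ext g b) = ext (conj g \<mu> \<otimes>\<^bsub>A\<^esub> g) b"
      using single c by (simp only: ext_mult)
    also have "conj g \<mu> \<otimes>\<^bsub>A\<^esub> g = g \<otimes>\<^bsub>A\<^esub> \<mu>"
      using c by (simp add: A.m_assoc)
    finally have "ext (conj g \<mu>) (ext g b) = ext g (ext \<mu> b)"
      using single c ext_mult by simp
    moreover have "ext \<mu> b \<in> carrier L" using skew.action_closed M single by simp
    ultimately show ?case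
      using single M c conj_mult[of g \<mu> \<nu>] ring_hom_closed[OF ext_G_hom] ring_hom_mult[OF ext_G_hom]
      by (simp add: skew.single_mult_single action_single)
  next
    case (add h k)
    then show ?case
      by (simp add: skew.skew_r_distr skew.single_carrier skew.skew_mult_closed action_add action_carrier)
  qed
next
  case (add f k)
  then show ?case
    by (simp add: skew.skew_l_distr skew.skew_mult_closed action_add action_carrier)
qed

lemma action_one: "galois_action L \<Lambda> M g \<one>\<^bsub>skew.S\<^esub> = \<one>\<^bsub>skew.S\<^esub>"
  using G_carrier[OF g] submonoid.one_closed[OF M_submonoid] ring_hom_one[OF ext_G_hom]
  by (simp add: skew.skew_one action_single)

lemma action_uminus:
  assumes "f \<in> carrier skew.S"
  shows "galois_action L \<Lambda> M g (\<ominus>\<^bsub>skew.S\<^esub> f) = \<ominus>\<^bsub>skew.S\<^esub> galois_action L \<Lambda> M g f"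
proof -
  interpret h: ring_hom_cring L L "ext g"
    using ext_G_hom by unfold_locales
  show ?thesis
    using assms by (auto simp: skew.skew_uminus action_carrier action_apply)
qed

end

lemma K_iff: "f \<in> carrier \<K> \<longleftrightarrow> f \<in> carrier skew.S \<and> (\<forall>g\<in>G. galois_action L \<Lambda> M g f = f)"
  by (simp add: galois_fixed_ring_def galois_skew_ring_def)

text \<open>Only the carrier distinguishes \<open>\<K>\<close> from the skew monoid ring, so general
  facts on subrings give its ring structure.\<close>

lemma K_eq: "\<K> = skew.S\<lparr>carrier := carrier \<K>\<rparr>"
  by (simp add: galois_fixed_ring_def galois_skew_ring_def)

lemma K_subring: "subring (carrier \<K>) skew.S"
  by (rule skew.subringI)
    (auto simp: K_iff action_one action_uminus action_mult action_add
      skew.skew_one_closed skew.skew_mult_closed skew.skew_add_closed)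

lemma K_ring: "ring \<K>"
  using skew.subring_is_ring[OF K_subring] K_eq by simp

lemma K_ops:
  "f \<otimes>\<^bsub>\<K>\<^esub> h = f \<otimes>\<^bsub>skew.S\<^esub> h" "f \<oplus>\<^bsub>\<K>\<^esub> h = f \<oplus>\<^bsub>skew.S\<^esub> h" "\<zero>\<^bsub>\<K>\<^esub> = \<zero>\<^bsub>skew.S\<^esub>" "\<one>\<^bsub>\<K>\<^esub> = \<one>\<^bsub>skew.S\<^esub>"
  by (simp_all add: galois_fixed_ring_def galois_skew_ring_def)

end

section \<open>Division by elements of the base ring\<close>

context galois_setting
begin

abbreviation scalar where "scalar \<equiv> skew.single \<one>\<^bsub>A\<^esub>"

lemma \<Gamma>_\<Lambda>: "a \<in> \<Gamma> \<Longrightarrow> a \<in> \<Lambda>"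
  by (simp add: fixed_subring_def)

lemma \<Gamma>_carrier: "a \<in> \<Gamma> \<Longrightarrow> a \<in> carrier L"
  using \<Gamma>_\<Lambda> \<Lambda>_carrier by blast

lemma \<Gamma>_subring: "subring \<Gamma> L"
proof (rule subringI)
  show "\<Gamma> \<subseteq> carrier L" using \<Gamma>_carrier by blast
  show "\<one> \<in> \<Gamma>" using \<Lambda>_closed(3) aut_one G_carrier by (simp add: fixed_subring_def)
  show "\<ominus> a \<in> \<Gamma>" if a: "a \<in> \<Gamma>" for a
  proof -
    have "g (\<ominus> a) = \<ominus> a" if g: "g \<in> G" for g
    proof -
      have "a \<in> \<Lambda>" "g a = a" using a g by (auto simp: fixed_subring_def)
      moreover from this have "g (\<ominus> a) \<oplus> a = \<zero>"
        using aut_add[OF G_carrier[OF g], of "\<ominus> a" a] aut_zero[OF G_carrier[OF g]]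
          \<Lambda>_closed(5) \<Lambda>_carrier l_neg by simp
      ultimately show ?thesis
        using minus_equality[of "g (\<ominus> a)" a] aut_closed[OF G_carrier[OF g]] \<Lambda>_closed(5) \<Lambda>_carrier by simp
    qed
    then show ?thesis using a \<Lambda>_closed(5) by (simp add: fixed_subring_def)
  qed
  show "a \<otimes> b \<in> \<Gamma>" "a \<oplus> b \<in> \<Gamma>" if "a \<in> \<Gamma>" "b \<in> \<Gamma>" for a b
  proof -
    have ab: "a \<in> \<Lambda>" "b \<in> \<Lambda>" "\<And>g. g \<in> G \<Longrightarrow> g a = a" "\<And>g. g \<in> G \<Longrightarrow> g b = b"
      using that by (auto simp: fixed_subring_def)
    have "g (a \<otimes> b) = a \<otimes> b" "g (a \<oplus> b) = a \<oplus> b" if g: "g \<in> G" for g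
      using ab(1,2) ab(3,4)[OF g]
      by (simp_all add: aut_mult[OF G_carrier[OF g]] aut_add[OF G_carrier[OF g]])
    then show "a \<otimes> b \<in> \<Gamma>" "a \<oplus> b \<in> \<Gamma>"
      using ab(1,2) \<Lambda>_closed(6,7) by (simp_all add: fixed_subring_def)
  qed
qed

lemmas \<Gamma>_closed = subringE[OF \<Gamma>_subring]

lemma ext_\<Gamma>: "\<lbrakk> g \<in> G; a \<in> \<Gamma> \<rbrakk> \<Longrightarrow> ext g a = a"
  using ext_base[of g a] G_carrier[of g] by (simp add: fixed_subring_def)

lemma ext_inv_\<Gamma>:
  assumes "g \<in> G" "a \<in> \<Gamma>" "a \<noteq> \<zero>"
  shows "ext g (inv a) = inv a"
proof -
  have "g a = a" "a \<in> \<Lambda>" using assms by (auto simp: fixed_subring_def)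
  then show ?thesis
    using assms ext_fraction[OF G_carrier[OF assms(1)] \<Lambda>_closed(3), of a]
      aut_one[OF G_carrier[OF assms(1)]] inv_closed \<Lambda>_carrier by simp
qed

lemma M_one: "\<one>\<^bsub>A\<^esub> \<in> M"
  using submonoid.one_closed[OF M_submonoid] .

lemma scalar_K:
  assumes "a \<in> carrier L" "\<And>g. g \<in> G \<Longrightarrow> ext g a = a"
  shows "scalar a \<in> carrier \<K>"
  using assms M_one skew.single_carrier G_carrier by (auto simp: K_iff action_single)

lemma scalar_\<Gamma>: "a \<in> \<Gamma> \<Longrightarrow> scalar a \<in> carrier \<K>"
  using scalar_K ext_\<Gamma> \<Gamma>_carrier by blast

lemma scalar_inv_\<Gamma>: "\<lbrakk> a \<in> \<Gamma>; a \<noteq> \<zero> \<rbrakk> \<Longrightarrow> scalar (inv a) \<in> carrier \<K>"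
  using scalar_K ext_inv_\<Gamma> \<Gamma>_carrier inv_closed by blast

lemma scalar_mult_scalar:
  "\<lbrakk> a \<in> carrier L; b \<in> carrier L \<rbrakk> \<Longrightarrow> scalar a \<otimes>\<^bsub>\<K>\<^esub> scalar b = scalar (a \<otimes> b)"
  using M_one skew.single_mult_single[of "\<one>\<^bsub>A\<^esub>" a "\<one>\<^bsub>A\<^esub>" b] by (simp add: K_ops ext_one)

lemma scalar_one: "scalar \<one> = \<one>\<^bsub>\<K>\<^esub>"
  by (simp add: K_ops skew.skew_one)

lemma scalar_inverse:
  assumes "a \<in> \<Gamma>" "a \<noteq> \<zero>"
  shows "scalar a \<otimes>\<^bsub>\<K>\<^esub> scalar (inv a) = \<one>\<^bsub>\<K>\<^esub>" "scalar (inv a) \<otimes>\<^bsub>\<K>\<^esub> scalar a = \<one>\<^bsub>\<K>\<^esub>"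
  using assms \<Gamma>_carrier inv_closed by (auto simp: scalar_mult_scalar mult_inv scalar_one)

lemma galois_embed_scalar: "galois_embed L \<Lambda> B = scalar ` B"
  by (simp add: galois_embed_def skew_const_def skew.single_def)

text \<open>The \<Gamma>-span of 1, y, ..., y^(n-1), in Horner form. The index counts coefficients
  rather than degree, so index 0 gives only zero and index 1 gives \<Gamma>. The Horner form splits
  off the constant term and matches the recursion in \<open>left_division\<close>, where each
  further coefficient costs one left multiplication by c.\<close>

primrec polys :: "'a \<Rightarrow> nat \<Rightarrow> 'a set" where
  "polys y 0 = {\<zero>}"
| "polys y (Suc n) = {p \<oplus> y \<otimes> x | p x. p \<in> \<Gamma> \<and> x \<in> polys y n}"

context
  fixes y assumes y: "y \<in> \<Lambda>"
begin

lemma polys_\<Lambda>: "x \<in> polys y n \<Longrightarrow> x \<in> \<Lambda>"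
  using y \<Gamma>_\<Lambda> \<Lambda>_closed by (induction n arbitrary: x) auto

lemma polys_carrier: "x \<in> polys y n \<Longrightarrow> x \<in> carrier L"
  using polys_\<Lambda> \<Lambda>_carrier by blast

lemma polys_SucI: "\<lbrakk> p \<in> \<Gamma>; x \<in> polys y n \<rbrakk> \<Longrightarrow> p \<oplus> y \<otimes> x \<in> polys y (Suc n)"
  by auto

lemma polys_zero: "\<zero> \<in> polys y n"
proof (induction n)
  case (Suc n)
  have "\<zero> = \<zero> \<oplus> y \<otimes> \<zero>" using y \<Lambda>_carrier by simp
  then show ?case using Suc \<Gamma>_closed(2) by auto
qed simp

lemma polys_add: "\<lbrakk> x \<in> polys y n; x' \<in> polys y n \<rbrakk> \<Longrightarrow> x \<oplus> x' \<in> polys y n"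
proof (induction n arbitrary: x x')
  case (Suc n)
  then obtain p z p' z' where *: "p \<in> \<Gamma>" "z \<in> polys y n" "x = p \<oplus> y \<otimes> z"
    "p' \<in> \<Gamma>" "z' \<in> polys y n" "x' = p' \<oplus> y \<otimes> z'"
    by auto
  then have "x \<oplus> x' = (p \<oplus> p') \<oplus> y \<otimes> (z \<oplus> z')"
    using y \<Lambda>_carrier \<Gamma>_carrier polys_carrier by (simp add: r_distr a_ac)
  then show ?case using polys_SucI[OF \<Gamma>_closed(7)[OF *(1,4)] Suc.IH[OF *(2,5)]] by (simp only:)
qed simp

lemma polys_smult: "\<lbrakk> a \<in> \<Gamma>; x \<in> polys y n \<rbrakk> \<Longrightarrow> a \<otimes> x \<in> polys y n"
proof (induction n arbitrary: x)
  case 0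
  then show ?case using \<Gamma>_carrier by simp
next
  case (Suc n)
  then obtain p z where *: "p \<in> \<Gamma>" "z \<in> polys y n" "x = p \<oplus> y \<otimes> z"
    by auto
  then have "a \<otimes> x = (a \<otimes> p) \<oplus> y \<otimes> (a \<otimes> z)"
    using y \<Lambda>_carrier \<Gamma>_carrier polys_carrier Suc.prems by (simp add: r_distr m_ac)
  then show ?case using polys_SucI[OF \<Gamma>_closed(6)[OF Suc.prems(1) *(1)] Suc.IH[OF Suc.prems(1) *(2)]]
    by (simp only:)
qed

lemma polys_uminus:
  assumes "x \<in> polys y n"
  shows "\<ominus> x \<in> polys y n"
proof -
  have "(\<ominus> \<one>) \<otimes> x \<in> polys y n"
    using assms polys_smult \<Gamma>_closed(3,5) by blast
  then show ?thesis using polys_carrier[OF assms] by (simp add: l_minus)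
qed

lemma polys_mono: "polys y n \<subseteq> polys y (Suc n)"
proof (induction n)
  case 0
  then show ?case using polys_zero[of "Suc 0"] by (simp del: polys.simps(2))
next
  case (Suc n)
  then show ?case by auto
qed

text \<open>This is where \<Lambda> being Noetherian over \<Gamma> enters: the sets form an
  ascending chain of \<Gamma>-submodules of \<Lambda>.\<close>

lemma polys_stationary: "\<exists>n. polys y (Suc n) \<subseteq> polys y n"
proof -
  let ?N = "\<lparr>carrier = \<Lambda>, monoid.mult = monoid.mult L, one = one L, ring.zero = ring.zero L,
    add = add L, smult = monoid.mult L\<rparr>"
  have mod: "module (L\<lparr>carrier := \<Gamma>\<rparr>) ?N"
    and acc: "satisfies_acc {N. submodule N (L\<lparr>carrier := \<Gamma>\<rparr>) ?N}"
    using noetherian by (auto simp: noetherian_module_def)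
  interpret N: module "L\<lparr>carrier := \<Gamma>\<rparr>" ?N by (rule mod)
  have "submodule (polys y n) (L\<lparr>carrier := \<Gamma>\<rparr>) ?N" for n
  proof (rule N.submoduleI)
    show "\<ominus>\<^bsub>?N\<^esub> x \<in> polys y n" if "x \<in> polys y n" for x
    proof -
      have "\<ominus>\<^bsub>?N\<^esub> x = \<ominus> x"
        using that N.minus_equality[of "\<ominus> x" x] polys_\<Lambda> polys_carrier \<Lambda>_closed(5)
        by (simp add: l_neg)
      then show ?thesis using polys_uminus that by simp
    qed
  qed (auto simp: polys_\<Lambda> polys_zero polys_add polys_smult)
  then obtain n where "\<forall>m\<ge>n. polys y m = polys y n"
    using acc[unfolded satisfies_acc_def, rule_format, of "polys y"] polys_mono by blast
  then have "polys y (Suc n) = polys y n" using le_SucI by blast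
  then show ?thesis by blast
qed

text \<open>If no nonzero element of \<open>\<Gamma>\<close> were a multiple of \<open>y\<close> in \<open>\<Gamma>[y]\<close>, constant coefficients of
  polynomials in \<open>y\<close> would be well defined, and stationarity could be pushed down to degree \<open>0\<close>.\<close>

lemma relation_with_constant_term:
  assumes "y \<noteq> \<zero>"
  shows "\<exists>n. \<exists>p\<in>\<Gamma>. \<exists>x\<in>polys y n. p \<noteq> \<zero> \<and> p \<oplus> y \<otimes> x = \<zero>"
proof (rule ccontr)
  assume "\<not> ?thesis"
  then have H: "p = \<zero>" if "p \<in> \<Gamma>" "x \<in> polys y n" "p \<oplus> y \<otimes> x = \<zero>" for p x n
    using that by blast
  have yc: "y \<in> carrier L" using y \<Lambda>_carrier by blast
  have down: "polys y (Suc k) \<subseteq> polys y k" if le: "polys y (Suc (Suc k)) \<subseteq> polys y (Suc k)" for k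
  proof
    fix x assume x: "x \<in> polys y (Suc k)"
    have xc: "x \<in> carrier L" using x by (rule polys_carrier)
    have "\<zero> \<oplus> y \<otimes> x \<in> polys y (Suc (Suc k))"
      using polys_SucI[OF \<Gamma>_closed(2) x] .
    moreover have "\<zero> \<oplus> y \<otimes> x = y \<otimes> x" using xc yc by simp
    ultimately have "y \<otimes> x \<in> polys y (Suc k)" using le by (metis subsetD)
    then obtain p x' where p: "p \<in> \<Gamma>" "x' \<in> polys y k" "y \<otimes> x = p \<oplus> y \<otimes> x'" by auto
    have x'c: "x' \<in> carrier L" using p(2) by (rule polys_carrier)
    \<comment> \<open>Subtracting the two expressions for y x gives a relation with constant term p,
      which must vanish by \<open>H\<close>. Then y cancels in the domain, leaving x = x' with one
      coefficient fewer.\<close>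
    have "x' \<oplus> \<ominus> x \<in> polys y (Suc k)"
      using polys_add polys_uminus x p polys_mono by blast
    moreover have "p \<oplus> y \<otimes> (x' \<oplus> \<ominus> x) = \<zero>"
      using p(1) xc x'c yc \<Gamma>_carrier p(3)[symmetric]
      by (simp add: r_distr r_minus a_assoc[symmetric] r_neg)
    ultimately have "p = \<zero>" using H p(1) by blast
    then have "y \<otimes> x = y \<otimes> x'" using p x'c yc by simp
    then have "x = x'" using m_lcancel[of y x x'] assms xc x'c yc by blast
    then show "x \<in> polys y k" using p by simp
  qed
  obtain n where "polys y (Suc n) \<subseteq> polys y n" using polys_stationary by blast
  then have "polys y (Suc 0) \<subseteq> polys y 0"
    by (induction n) (use down in blast)+
  \<comment> \<open>At the bottom of the descent the constant 1 would lie in the zero set.\<close>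
  moreover have "\<one> \<oplus> y \<otimes> \<zero> \<in> polys y (Suc 0)" using \<Gamma>_closed(3) by auto
  ultimately show False using yc by auto
qed

end

text \<open>Division by \<open>c\<close> is by induction on the support of \<open>w\<close>. For \<open>\<mu>\<close> in the support put
  \<open>y = \<mu>\<^sup>-\<^sup>1(c)\<close>: the polynomial relation \<open>p + y x = 0\<close> yields \<open>w' \<in> W\<close> such that \<open>w p + c w'\<close>
  has no \<open>\<mu>\<close>-coefficient.\<close>

lemma left_division:
  assumes W: "right_ideal W \<K>" and c: "c \<in> \<Gamma>" "c \<noteq> \<zero>"
    and stable: "\<And>w. w \<in> W \<Longrightarrow> scalar c \<otimes>\<^bsub>\<K>\<^esub> w \<in> W"
    and w: "w \<in> W"
  shows "scalar (inv c) \<otimes>\<^bsub>\<K>\<^esub> w \<in> W"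
  using w
proof (induction "card (skew.support w)" arbitrary: w rule: less_induct)
  case less
  interpret K: ring \<K> by (rule K_ring)
  interpret W: right_ideal W \<K> by (rule W)
  have W_K: "v \<in> carrier \<K>" if "v \<in> W" for v using that W.a_subset by blast
  then have W_S: "v \<in> carrier skew.S" if "v \<in> W" for v using that by (simp add: K_iff)
  have wK: "w \<in> carrier \<K>" and wS: "w \<in> carrier skew.S" using less W_K W_S by auto
  note cK = scalar_\<Gamma>[OF c(1)] scalar_inv_\<Gamma>[OF c]
  have cL: "c \<in> carrier L" using c \<Gamma>_carrier by blast
  show ?case
  proof (cases "skew.support w = {}")
    case True
    then have "w = \<zero>\<^bsub>\<K>\<^esub>" by (auto simp: K_ops skew.skew_zero skew.support_def)
    then show ?thesis using cK W.zero_closed by simp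
  next
    case False
    then obtain \<mu> where \<mu>: "\<mu> \<in> skew.support w" by blast
    then have \<mu>M: "\<mu> \<in> M" using skew.skew_support[OF wS] by auto
    note \<mu>A = M_carrier[OF \<mu>M]
    \<comment> \<open>The preimage y of c lies in \<Lambda> but in general not in \<Gamma>, so it is
      not itself available as a right scalar; only a relation for it over \<Gamma> is.\<close>
    have "c \<in> \<mu> ` \<Lambda>" using \<Gamma>_\<Lambda>[OF c(1)] by (simp only: aut_surj[OF \<mu>A])
    then obtain y where y: "y \<in> \<Lambda>" "\<mu> y = c" by blast
    have "y \<noteq> \<zero>" using y c aut_zero[OF \<mu>A] by auto
    then obtain n p x where p: "p \<in> \<Gamma>" "x \<in> polys y n" "p \<noteq> \<zero>" "p \<oplus> y \<otimes> x = \<zero>"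
      using relation_with_constant_term[OF y(1)] by blast
    \<comment> \<open>One Horner step: if v has the factor \<mu>(z) at \<mu>, then w q + c v has
      \<mu>(q + y z), because the left factor c is \<mu>(y). At other elements the coefficients are
      not controlled; it suffices that no new support arises.\<close>
    have step: "w \<otimes>\<^bsub>\<K>\<^esub> scalar q \<oplus>\<^bsub>\<K>\<^esub> scalar c \<otimes>\<^bsub>\<K>\<^esub> v \<in> W \<and>
        skew.support (w \<otimes>\<^bsub>\<K>\<^esub> scalar q \<oplus>\<^bsub>\<K>\<^esub> scalar c \<otimes>\<^bsub>\<K>\<^esub> v) \<subseteq> skew.support w \<and>
        (w \<otimes>\<^bsub>\<K>\<^esub> scalar q \<oplus>\<^bsub>\<K>\<^esub> scalar c \<otimes>\<^bsub>\<K>\<^esub> v) \<mu> = w \<mu> \<otimes> \<mu> (q \<oplus> y \<otimes> z)"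
      if q: "q \<in> \<Gamma>" and z: "z \<in> \<Lambda>"
        and v: "v \<in> W" "skew.support v \<subseteq> skew.support w" "v \<mu> = w \<mu> \<otimes> \<mu> z" for q z v
    proof (intro conjI)
      show "w \<otimes>\<^bsub>\<K>\<^esub> scalar q \<oplus>\<^bsub>\<K>\<^esub> scalar c \<otimes>\<^bsub>\<K>\<^esub> v \<in> W"
        using W.r_closed[OF less.prems scalar_\<Gamma>[OF q]] stable[OF v(1)] W.a_closed by blast
      have qL: "q \<in> carrier L" using q \<Gamma>_carrier by blast
      have coeff: "(w \<otimes>\<^bsub>\<K>\<^esub> scalar q \<oplus>\<^bsub>\<K>\<^esub> scalar c \<otimes>\<^bsub>\<K>\<^esub> v) \<rho> =
          (if \<rho> \<in> M then w \<rho> \<otimes> ext \<rho> q else \<zero>) \<oplus> c \<otimes> v \<rho>" for \<rho>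
        using skew.mult_scalar[OF wS qL] skew.scalar_mult[OF W_S[OF v(1)] cL]
        by (simp add: K_ops skew.skew_add)
      show "skew.support (w \<otimes>\<^bsub>\<K>\<^esub> scalar q \<oplus>\<^bsub>\<K>\<^esub> scalar c \<otimes>\<^bsub>\<K>\<^esub> v) \<subseteq> skew.support w"
      proof
        fix \<rho> assume "\<rho> \<in> skew.support (w \<otimes>\<^bsub>\<K>\<^esub> scalar q \<oplus>\<^bsub>\<K>\<^esub> scalar c \<otimes>\<^bsub>\<K>\<^esub> v)"
        then have nz: "(if \<rho> \<in> M then w \<rho> \<otimes> ext \<rho> q else \<zero>) \<oplus> c \<otimes> v \<rho> \<noteq> \<zero>"
          by (simp add: skew.support_def coeff)
        show "\<rho> \<in> skew.support w"
        proof (rule ccontr)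
          assume "\<rho> \<notin> skew.support w"
          then have "w \<rho> = \<zero>" "v \<rho> = \<zero>" using v(2) by (auto simp: skew.support_def)
          moreover have "ext \<rho> q \<in> carrier L" if "\<rho> \<in> M"
            using that qL skew.action_closed by simp
          ultimately show False using nz cL by (cases "\<rho> \<in> M") auto
        qed
      qed
      have "(w \<otimes>\<^bsub>\<K>\<^esub> scalar q \<oplus>\<^bsub>\<K>\<^esub> scalar c \<otimes>\<^bsub>\<K>\<^esub> v) \<mu> = w \<mu> \<otimes> \<mu> q \<oplus> \<mu> y \<otimes> (w \<mu> \<otimes> \<mu> z)"
        using coeff[of \<mu>] \<mu>M ext_base[OF \<mu>A \<Gamma>_\<Lambda>[OF q]] v(3) y(2) by simp
      also have "\<dots> = w \<mu> \<otimes> (\<mu> q \<oplus> \<mu> y \<otimes> \<mu> z)"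
        using skew.skew_coeff[OF wS] aut_closed[OF \<mu>A] \<Gamma>_\<Lambda>[OF q] y(1) z \<Lambda>_carrier
        by (simp add: r_distr m_ac)
      also have "\<dots> = w \<mu> \<otimes> \<mu> (q \<oplus> y \<otimes> z)"
        using \<Gamma>_\<Lambda>[OF q] y(1) z \<Lambda>_closed(6) by (simp add: aut_add[OF \<mu>A] aut_mult[OF \<mu>A])
      finally show "(w \<otimes>\<^bsub>\<K>\<^esub> scalar q \<oplus>\<^bsub>\<K>\<^esub> scalar c \<otimes>\<^bsub>\<K>\<^esub> v) \<mu> = w \<mu> \<otimes> \<mu> (q \<oplus> y \<otimes> z)" .
    qed
    \<comment> \<open>Iterating the step, every polynomial value z in y is realized: its image under
      \<mu> multiplies the coefficient of w at \<mu>, without leaving \<open>W\<close> or enlarging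
      the support.\<close>
    have "\<exists>v\<in>W. skew.support v \<subseteq> skew.support w \<and> v \<mu> = w \<mu> \<otimes> \<mu> z" if "z \<in> polys y m" for z m
      using that
    proof (induction m arbitrary: z)
      case 0
      then show ?case
        using W.zero_closed skew.skew_coeff[OF wS] aut_zero[OF \<mu>A]
        by (intro bexI[of _ "\<zero>\<^bsub>\<K>\<^esub>"]) (auto simp: K_ops skew.skew_zero skew.support_def)
    next
      case (Suc m)
      then obtain q z' where q: "q \<in> \<Gamma>" "z' \<in> polys y m" "z = q \<oplus> y \<otimes> z'" by auto
      then obtain v where "v \<in> W" "skew.support v \<subseteq> skew.support w" "v \<mu> = w \<mu> \<otimes> \<mu> z'"
        using Suc.IH by blast
      then show ?case
        using step[OF q(1) polys_\<Lambda>[OF y(1) q(2)]] unfolding q(3) by blast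
    qed
    then obtain v where v: "v \<in> W" "skew.support v \<subseteq> skew.support w" "v \<mu> = w \<mu> \<otimes> \<mu> x"
      using p(2) by blast
    define u where "u = w \<otimes>\<^bsub>\<K>\<^esub> scalar p \<oplus>\<^bsub>\<K>\<^esub> scalar c \<otimes>\<^bsub>\<K>\<^esub> v"
    have u: "u \<in> W" "skew.support u \<subseteq> skew.support w" "u \<mu> = w \<mu> \<otimes> \<mu> (p \<oplus> y \<otimes> x)"
      using step[OF p(1) polys_\<Lambda>[OF y(1) p(2)] v] by (auto simp: u_def)
    have "u \<mu> = \<zero>" using u(3) p(4) aut_zero[OF \<mu>A] skew.skew_coeff[OF wS] by simp
    then have "skew.support u \<subset> skew.support w" using u(2) \<mu> by (auto simp: skew.support_def)
    then have "card (skew.support u) < card (skew.support w)"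
      using skew.skew_support(1)[OF wS] psubset_card_mono by blast
    then have uW: "scalar (inv c) \<otimes>\<^bsub>\<K>\<^esub> u \<in> W" using less.hyps u(1) by blast
    note pK = scalar_\<Gamma>[OF p(1)] scalar_inv_\<Gamma>[OF p(1,3)]
    \<comment> \<open>The outermost Horner step is kept visible for this: dividing u = w p + c v by
      c gives c^-1 w p + v, where v itself lies in \<open>W\<close>. So c^-1 w p is in
      \<open>W\<close>, and p can be inverted on the right because \<open>W\<close> is a right ideal
      of all of \<open>\<K>\<close>.\<close>
    let ?a = "scalar (inv c) \<otimes>\<^bsub>\<K>\<^esub> w \<otimes>\<^bsub>\<K>\<^esub> scalar p"
    have "scalar (inv c) \<otimes>\<^bsub>\<K>\<^esub> u =
        ?a \<oplus>\<^bsub>\<K>\<^esub> (scalar (inv c) \<otimes>\<^bsub>\<K>\<^esub> scalar c) \<otimes>\<^bsub>\<K>\<^esub> v"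
      using cK pK wK W_K[OF v(1)] by (simp add: u_def K.r_distr K.m_assoc)
    then have "scalar (inv c) \<otimes>\<^bsub>\<K>\<^esub> u = ?a \<oplus>\<^bsub>\<K>\<^esub> v"
      using scalar_inverse[OF c] W_K[OF v(1)] by simp
    then have "scalar (inv c) \<otimes>\<^bsub>\<K>\<^esub> u \<oplus>\<^bsub>\<K>\<^esub> \<ominus>\<^bsub>\<K>\<^esub> v = ?a"
      using cK pK wK W_K[OF v(1)] by (simp add: K.a_assoc K.r_neg)
    then have "?a \<in> W" using uW v(1) W.a_closed W.a_inv_closed by metis
    then have "?a \<otimes>\<^bsub>\<K>\<^esub> scalar (inv p) \<in> W" using W.r_closed pK by blast
    moreover have "?a \<otimes>\<^bsub>\<K>\<^esub> scalar (inv p) = scalar (inv c) \<otimes>\<^bsub>\<K>\<^esub> w"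
      using cK pK wK scalar_inverse[OF p(1,3)] by (simp add: K.m_assoc)
    ultimately show ?thesis by simp
  qed
qed

section \<open>Galois rings and denominators from the base ring\<close>

context
  fixes U assumes U: "galois_ring L \<Lambda> G M U"
begin

lemma galois_ringD:
  shows U_subring: "subring U \<K>"
    and scalar_U: "a \<in> \<Gamma> \<Longrightarrow> scalar a \<in> U"
    and KU: "ideal_prod \<K> (scalar ` fractions L \<Gamma>) U = carrier \<K>"
    and UK: "ideal_prod \<K> U (scalar ` fractions L \<Gamma>) = carrier \<K>"
  using U by (auto simp: galois_ring_def Let_def galois_embed_scalar)

lemma U_K: "u \<in> U \<Longrightarrow> u \<in> carrier \<K>"
  using subringE(1)[OF U_subring] by blast

lemma scalar_fraction:
  assumes "k \<in> fractions L \<Gamma>"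
  obtains a b where "a \<in> \<Gamma>" "b \<in> \<Gamma>" "b \<noteq> \<zero>" "scalar k \<in> carrier \<K>"
    "scalar b \<otimes>\<^bsub>\<K>\<^esub> scalar k = scalar a" "scalar k \<otimes>\<^bsub>\<K>\<^esub> scalar b = scalar a"
proof -
  obtain a b where ab: "a \<in> \<Gamma>" "b \<in> \<Gamma>" "b \<noteq> \<zero>" "k = a \<otimes> inv b"
    using assms by (auto simp: fractions_def)
  have c: "a \<in> carrier L" "b \<in> carrier L" "inv b \<in> carrier L" "k \<in> carrier L"
    using ab \<Gamma>_carrier inv_closed by auto
  interpret K: ring \<K> by (rule K_ring)
  have "scalar k = scalar a \<otimes>\<^bsub>\<K>\<^esub> scalar (inv b)" using ab c by (simp add: scalar_mult_scalar)
  then have "scalar k \<in> carrier \<K>" using ab scalar_\<Gamma> scalar_inv_\<Gamma> by simp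
  moreover have "b \<otimes> k = a" "k \<otimes> b = a"
    using ab c mult_inv[of b] by (simp_all add: m_ac)
  ultimately show thesis using that ab c by (simp add: scalar_mult_scalar)
qed

lemma denominators_product:
  "\<lbrakk> a \<in> \<Gamma> - {\<zero>}; b \<in> \<Gamma> - {\<zero>} \<rbrakk> \<Longrightarrow> a \<otimes> b \<in> \<Gamma> - {\<zero>}"
  using \<Gamma>_closed(6) integral \<Gamma>_carrier by blast

text \<open>An element of \<open>K U\<close> is a finite sum of terms k u with k a fraction over
  \<Gamma>; the product of the denominators of the k clears all terms, since \<Gamma> is
  commutative.\<close>

lemma left_denominator:
  assumes "x \<in> carrier \<K>"
  shows "\<exists>b\<in>\<Gamma> - {\<zero>}. scalar b \<otimes>\<^bsub>\<K>\<^esub> x \<in> U"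
proof -
  interpret K: ring \<K> by (rule K_ring)
  note Uc = subringE[OF U_subring]
  have "x \<in> ideal_prod \<K> (scalar ` fractions L \<Gamma>) U" using assms KU by simp
  \<comment> \<open>Membership in the carrier is carried through the induction because the sum case
    uses associativity and distributivity.\<close>
  then have "x \<in> carrier \<K> \<and> ?thesis"
  proof induction
    case (prod i u)
    then obtain k where k: "k \<in> fractions L \<Gamma>" "i = scalar k" by blast
    obtain a b where ab: "a \<in> \<Gamma>" "b \<in> \<Gamma>" "b \<noteq> \<zero>" "scalar k \<in> carrier \<K>"
      "scalar b \<otimes>\<^bsub>\<K>\<^esub> scalar k = scalar a"
      using scalar_fraction[OF k(1)] by blast
    have "scalar b \<otimes>\<^bsub>\<K>\<^esub> (i \<otimes>\<^bsub>\<K>\<^esub> u) = scalar a \<otimes>\<^bsub>\<K>\<^esub> u"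
      using k ab prod U_K scalar_\<Gamma> by (simp add: K.m_assoc[symmetric])
    also have "\<dots> \<in> U" using Uc(6) scalar_U ab prod by blast
    finally show ?case using k ab prod U_K by blast
  next
    case (sum x x')
    then obtain b b' where b: "b \<in> \<Gamma> - {\<zero>}" "scalar b \<otimes>\<^bsub>\<K>\<^esub> x \<in> U"
      "b' \<in> \<Gamma> - {\<zero>}" "scalar b' \<otimes>\<^bsub>\<K>\<^esub> x' \<in> U" by blast
    then have bL: "b \<in> carrier L" "b' \<in> carrier L" using \<Gamma>_carrier by auto
    have "scalar (b \<otimes> b') = scalar b' \<otimes>\<^bsub>\<K>\<^esub> scalar b" "scalar (b \<otimes> b') = scalar b \<otimes>\<^bsub>\<K>\<^esub> scalar b'"
      using bL by (simp_all add: scalar_mult_scalar m_comm)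
    then have "scalar (b \<otimes> b') \<otimes>\<^bsub>\<K>\<^esub> x = scalar b' \<otimes>\<^bsub>\<K>\<^esub> (scalar b \<otimes>\<^bsub>\<K>\<^esub> x)"
      "scalar (b \<otimes> b') \<otimes>\<^bsub>\<K>\<^esub> x' = scalar b \<otimes>\<^bsub>\<K>\<^esub> (scalar b' \<otimes>\<^bsub>\<K>\<^esub> x')"
      using b(1,3) sum scalar_\<Gamma> K.m_assoc by (metis DiffD1)+
    then have "scalar (b \<otimes> b') \<otimes>\<^bsub>\<K>\<^esub> x \<oplus>\<^bsub>\<K>\<^esub> scalar (b \<otimes> b') \<otimes>\<^bsub>\<K>\<^esub> x' \<in> U"
      using b Uc(6,7) scalar_U by auto
    then have "scalar (b \<otimes> b') \<otimes>\<^bsub>\<K>\<^esub> (x \<oplus>\<^bsub>\<K>\<^esub> x') \<in> U"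
      using sum scalar_\<Gamma> denominators_product[OF b(1,3)] by (simp add: K.r_distr)
    then show ?case using sum denominators_product[OF b(1,3)] by blast
  qed
  then show ?thesis by blast
qed

lemma right_denominator:
  assumes "x \<in> carrier \<K>"
  shows "\<exists>b\<in>\<Gamma> - {\<zero>}. x \<otimes>\<^bsub>\<K>\<^esub> scalar b \<in> U"
proof -
  interpret K: ring \<K> by (rule K_ring)
  note Uc = subringE[OF U_subring]
  have "x \<in> ideal_prod \<K> U (scalar ` fractions L \<Gamma>)" using assms UK by simp
  then have "x \<in> carrier \<K> \<and> ?thesis"
  proof induction
    case (prod u i)
    then obtain k where k: "k \<in> fractions L \<Gamma>" "i = scalar k" by blast
    obtain a b where ab: "a \<in> \<Gamma>" "b \<in> \<Gamma>" "b \<noteq> \<zero>" "scalar k \<in> carrier \<K>"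
      "scalar k \<otimes>\<^bsub>\<K>\<^esub> scalar b = scalar a"
      using scalar_fraction[OF k(1)] by blast
    have "(u \<otimes>\<^bsub>\<K>\<^esub> i) \<otimes>\<^bsub>\<K>\<^esub> scalar b = u \<otimes>\<^bsub>\<K>\<^esub> scalar a"
      using k ab prod U_K scalar_\<Gamma> by (simp add: K.m_assoc)
    also have "\<dots> \<in> U" using Uc(6) scalar_U ab prod by blast
    finally show ?case using k ab prod U_K by blast
  next
    case (sum x x')
    then obtain b b' where b: "b \<in> \<Gamma> - {\<zero>}" "x \<otimes>\<^bsub>\<K>\<^esub> scalar b \<in> U"
      "b' \<in> \<Gamma> - {\<zero>}" "x' \<otimes>\<^bsub>\<K>\<^esub> scalar b' \<in> U" by blast
    then have bL: "b \<in> carrier L" "b' \<in> carrier L" using \<Gamma>_carrier by auto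
    have "scalar (b \<otimes> b') = scalar b' \<otimes>\<^bsub>\<K>\<^esub> scalar b" "scalar (b \<otimes> b') = scalar b \<otimes>\<^bsub>\<K>\<^esub> scalar b'"
      using bL by (simp_all add: scalar_mult_scalar m_comm)
    then have "x \<otimes>\<^bsub>\<K>\<^esub> scalar (b \<otimes> b') = (x \<otimes>\<^bsub>\<K>\<^esub> scalar b) \<otimes>\<^bsub>\<K>\<^esub> scalar b'"
      "x' \<otimes>\<^bsub>\<K>\<^esub> scalar (b \<otimes> b') = (x' \<otimes>\<^bsub>\<K>\<^esub> scalar b') \<otimes>\<^bsub>\<K>\<^esub> scalar b"
      using b sum scalar_\<Gamma> by (auto simp: K.m_assoc)
    then have "x \<otimes>\<^bsub>\<K>\<^esub> scalar (b \<otimes> b') \<oplus>\<^bsub>\<K>\<^esub> x' \<otimes>\<^bsub>\<K>\<^esub> scalar (b \<otimes> b') \<in> U"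
      using b Uc(6,7) scalar_U by auto
    then have "(x \<oplus>\<^bsub>\<K>\<^esub> x') \<otimes>\<^bsub>\<K>\<^esub> scalar (b \<otimes> b') \<in> U"
      using sum scalar_\<Gamma> denominators_product[OF b(1,3)] by (simp add: K.l_distr)
    then show ?case using sum denominators_product[OF b(1,3)] by blast
  qed
  then show ?thesis by blast
qed

lemma scalar_Units: "b \<in> \<Gamma> - {\<zero>} \<Longrightarrow> scalar b \<in> Units \<K>"
  unfolding Units_def using scalar_inverse scalar_\<Gamma> scalar_inv_\<Gamma> by blast

lemma inv_scalar:
  assumes "b \<in> \<Gamma> - {\<zero>}"
  shows "inv\<^bsub>\<K>\<^esub> scalar b = scalar (inv b)"
proof -
  interpret K: ring \<K> by (rule K_ring)
  show ?thesis using assms by (intro K.inv_char) (auto simp: scalar_inverse scalar_\<Gamma> scalar_inv_\<Gamma>)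
qed

lemma ore_subring_U: "ore_subring \<K> U (scalar ` (\<Gamma> - {\<zero>}))"
proof (intro ore_subring.intro ore_subring_axioms.intro)
  show "ring \<K>" by (rule K_ring)
  show "subring U \<K>" by (rule U_subring)
  show "scalar ` (\<Gamma> - {\<zero>}) \<subseteq> U" using scalar_U by blast
  show "scalar ` (\<Gamma> - {\<zero>}) \<subseteq> Units \<K>" using scalar_Units by blast
  show "\<one>\<^bsub>\<K>\<^esub> \<in> scalar ` (\<Gamma> - {\<zero>})" using scalar_one \<Gamma>_closed(3) by force
  show "s \<otimes>\<^bsub>\<K>\<^esub> t \<in> scalar ` (\<Gamma> - {\<zero>})" "s \<otimes>\<^bsub>\<K>\<^esub> t = t \<otimes>\<^bsub>\<K>\<^esub> s"
    if st: "s \<in> scalar ` (\<Gamma> - {\<zero>})" "t \<in> scalar ` (\<Gamma> - {\<zero>})" for s t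
  proof -
    obtain a b where ab: "a \<in> \<Gamma> - {\<zero>}" "b \<in> \<Gamma> - {\<zero>}" "s = scalar a" "t = scalar b"
      using st by blast
    then show "s \<otimes>\<^bsub>\<K>\<^esub> t \<in> scalar ` (\<Gamma> - {\<zero>})"
      using denominators_product[OF ab(1,2)] \<Gamma>_carrier by (auto simp: scalar_mult_scalar)
    show "s \<otimes>\<^bsub>\<K>\<^esub> t = t \<otimes>\<^bsub>\<K>\<^esub> s"
      using ab \<Gamma>_carrier by (simp add: scalar_mult_scalar m_comm)
  qed
qed (use left_denominator right_denominator in blast)+

lemma ore_subring_extending_ideals_U:
  "ore_subring_extending_ideals \<K> U (scalar ` (\<Gamma> - {\<zero>}))"
proof -
  interpret O: ore_subring \<K> U "scalar ` (\<Gamma> - {\<zero>})" by (rule ore_subring_U)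
  show ?thesis
  proof (intro ore_subring_extending_ideals.intro ore_subring_extending_ideals_axioms.intro)
    show "ore_subring \<K> U (scalar ` (\<Gamma> - {\<zero>}))" by (rule ore_subring_U)
    fix I x s assume I: "ideal I (\<K>\<lparr>carrier := U\<rparr>)" and x: "x \<in> O.extension I"
      and "s \<in> scalar ` (\<Gamma> - {\<zero>})"
    then obtain c where c: "c \<in> \<Gamma> - {\<zero>}" "s = scalar c" by blast
    have "right_ideal (O.extension I) \<K>" using I O.right_ideal_extension by (simp add: O.ideal_P_iff)
    \<comment> \<open>That \<open>I\<close> is a left ideal of \<open>U\<close> enters here: c (w t)
      stays in \<open>I\<close>, so \<open>extension I\<close> is stable under c.
      \<open>left_division\<close> turns this into stability under c^-1.\<close>
    moreover have "scalar c \<otimes>\<^bsub>\<K>\<^esub> w \<in> O.extension I" if "w \<in> O.extension I" for w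
    proof -
      obtain t where t: "w \<in> carrier \<K>" "t \<in> scalar ` (\<Gamma> - {\<zero>})" "w \<otimes>\<^bsub>\<K>\<^esub> t \<in> I"
        using O.extensionE[OF \<open>w \<in> O.extension I\<close>] .
      have "scalar c \<otimes>\<^bsub>\<K>\<^esub> (w \<otimes>\<^bsub>\<K>\<^esub> t) \<in> I"
        using I t(3) scalar_U c(1) by (auto simp: O.ideal_P_iff)
      then show ?thesis
        using t c(1) scalar_\<Gamma> O.S_carrier[OF t(2)]
        by (intro O.extensionI[OF _ t(2)]) (auto simp: O.m_assoc)
    qed
    ultimately show "inv\<^bsub>\<K>\<^esub> s \<otimes>\<^bsub>\<K>\<^esub> x \<in> O.extension I"
      using left_division[of "O.extension I" c x] c x by (simp add: inv_scalar)
  qed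
qed

end

end

theorem theorem3p12:
  fixes L :: "('a, 'b) ring_scheme" and \<Lambda> :: "'a set"
    and G M :: "('a \<Rightarrow> 'a) set" and U :: "(('a \<Rightarrow> 'a) \<Rightarrow> 'a) set"
  assumes "galois_setting L \<Lambda> G M"
    and "galois_ring L \<Lambda> G M U"
  shows "(prime_ring ((galois_fixed_ring L \<Lambda> G M)\<lparr>carrier := U\<rparr>) \<and>
          right_goldie_ring ((galois_fixed_ring L \<Lambda> G M)\<lparr>carrier := U\<rparr>)
            \<longleftrightarrow> prime_ring (galois_fixed_ring L \<Lambda> G M) \<and>
                right_goldie_ring (galois_fixed_ring L \<Lambda> G M)) \<and>
         (semiprime_ring ((galois_fixed_ring L \<Lambda> G M)\<lparr>carrier := U\<rparr>) \<and>
          right_goldie_ring ((galois_fixed_ring L \<Lambda> G M)\<lparr>carrier := U\<rparr>)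
            \<longleftrightarrow> semiprime_ring (galois_fixed_ring L \<Lambda> G M) \<and>
                right_goldie_ring (galois_fixed_ring L \<Lambda> G M))"
proof -
  \<comment> \<open>The denominators are the nonzero elements of \<Gamma>, with
    \<open>scalar\<close> spelled out since this is outside the locale. The prime, semiprime and
    Goldie conditions transfer separately, hence so do their conjunctions.\<close>
  interpret ore_subring_extending_ideals "galois_fixed_ring L \<Lambda> G M" U
    "skew_action.single L \<one>\<^bsub>RingAut (L\<lparr>carrier := \<Lambda>\<rparr>)\<^esub> ` (fixed_subring \<Lambda> G - {\<zero>\<^bsub>L\<^esub>})"
    using galois_setting.ore_subring_extending_ideals_U[OF assms] .
  show ?thesis using prime_ring_iff semiprime_ring_iff right_goldie_iff by blast
qed

end
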